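(* Fix $\gamma>0$ and $\alpha_0\in(0,1)$. For the problem of testing $$H_0:\ X_i\overset{\text{i.i.d.}}{\sim}\mathrm{GN}_\gamma(0),\qquad H_1^{(n)}:\ X_i\overset{\text{i.i.d.}}{\sim}(1-\varepsilon_n)\,\mathrm{GN}_\gamma(0)+\varepsilon_n\,\mathrm{GN}_\gamma(\mu_n),\qquad 1\le i\le n,$$ with $\varepsilon_n=n^{-\beta}$ and $\mu_n=(\gamma r\log(n))^{1/\gamma}$, $\tfrac12<\beta<1$, $0<r<1$, consider applying higher criticism to the $p$-values $p_i=P\{\mathrm{GN}_\gamma(0)>X_i\}$, $i=1,\dots,n$. Then the detection boundary $\rho_{\mathrm{HC},\gamma}$ of this procedure is the same as the efficient detection boundary: $$\rho_{\mathrm{HC},\gamma}(\beta)=\rho_\gamma^*(\beta),\qquad \tfrac12<\beta<1,$$ where for $\gamma>1$ $$\rho_\gamma^*(\beta)=\begin{cases}(2^{1/(\gamma-1)}-1)^{\gamma-1}(\beta-\tfrac12),&\tfrac12<\beta\le1-2^{-\gamma/(\gamma-1)},\\ (1-(1-\beta)^{1/\gamma})^\gamma,&1-2^{-\gamma/(\gamma-1)}\le\beta<1,\end{cases}$$ and for $0<\gamma\le1$ $$\rho_\gamma^*(\beta)=2(\beta-\tfrac12),\qquad\tfrac12<\beta<1 .$$ That is, for the tests rejecting $H_0$ when $\mathrm{HC}_n^*>h(n,\alpha_n)$, with levels $\alpha_n\to0$ slowly enough, as $n\to\infty$: if $r>\rho_\gamma^*(\beta)$ then $P_{H_1^{(n)}}\{\mathrm{HC}_n^*>h(n,\alpha_n)\}\to1$,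 and if $r<\rho_\gamma^*(\beta)$ then $P_{H_1^{(n)}}\{\mathrm{HC}_n^*>h(n,\alpha_n)\}\to0$.
   Context: $\mathrm{GN}_\gamma(\mu)$ is the generalized Gaussian (Subbotin) distribution on $\mathbb{R}$ with density $$\frac1{C_\gamma}\exp\left(-\frac{|x-\mu|^\gamma}{\gamma}\right),\qquad C_\gamma=2\,\Gamma\!\left(\tfrac1\gamma\right)\gamma^{1/\gamma-1}.$$ With the sorted $p$-values $p_{(1)}\le\dots\le p_{(n)}$ and a fixed $\alpha_0\in(0,1)$, the higher criticism statistic is $$\mathrm{HC}_n^*=\max_{1\le i\le \alpha_0 n}\ \frac{\sqrt n\,[\,i/n-p_{(i)}\,]}{\sqrt{p_{(i)}(1-p_{(i)})}} .$$ $h(n,\alpha)$ denotes a critical value of the level-$\alpha$ test, so that $P_{H_0}\{\mathrm{HC}_n^*>h(n,\alpha)\}\le\alpha$. One says that $\alpha_n\to0$ slowly enough if $\alpha_n\to 0$ and $h(n,\alpha_n)=\sqrt{2\log\log(n)}\,(1+o(1))$. *)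

theory Defs
  imports "HOL-Probability.Probability" "HOL-Library.Landau_Symbols"
begin

definition GN_density :: "real \<Rightarrow> real \<Rightarrow> real \<Rightarrow> real" where
  "GN_density \<gamma> \<mu> x =
     exp (- (\<bar>x - \<mu>\<bar> powr \<gamma>) / \<gamma>) / (2 * Gamma (1 / \<gamma>) * \<gamma> powr (1 / \<gamma> - 1))"

definition GN :: "real \<Rightarrow> real \<Rightarrow> real measure" where
  "GN \<gamma> \<mu> = density lborel (\<lambda>x. ennreal (GN_density \<gamma> \<mu> x))"

definition GN_mixture :: "real \<Rightarrow> real \<Rightarrow> real \<Rightarrow> real measure" where
  "GN_mixture \<gamma> \<epsilon> \<mu> =
     density lborel (\<lambda>x. ennreal ((1 - \<epsilon>) * GN_density \<gamma> 0 x + \<epsilon> * GN_density \<gamma> \<mu> x))"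

text \<open>A sample of size \<open>n\<close> is a function on the index set \<open>{1..n}\<close>;
  its law is the product measure on that index set.\<close>

definition H0_law :: "real \<Rightarrow> nat \<Rightarrow> (nat \<Rightarrow> real) measure" where
  "H0_law \<gamma> n = PiM {1..n} (\<lambda>i. GN \<gamma> 0)"

definition sparsity :: "real \<Rightarrow> nat \<Rightarrow> real" where
  "sparsity \<beta> n = real n powr (- \<beta>)"

definition signal_mean :: "real \<Rightarrow> real \<Rightarrow> nat \<Rightarrow> real" where
  "signal_mean \<gamma> r n = (\<gamma> * r * ln (real n)) powr (1 / \<gamma>)"

definition H1_law :: "real \<Rightarrow> real \<Rightarrow> real \<Rightarrow> nat \<Rightarrow> (nat \<Rightarrow> real) measure" where
  "H1_law \<gamma> \<beta> r n = PiM {1..n} (\<lambda>i. GN_mixture \<gamma> (sparsity \<beta> n) (signal_mean \<gamma> r n))"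

definition p_value :: "real \<Rightarrow> real \<Rightarrow> real" where
  "p_value \<gamma> x = measure (GN \<gamma> 0) {x<..}"

text \<open>The \<open>i\<close>-th smallest p-value, with \<open>i\<close> counted from 1.\<close>

definition sorted_p_value :: "real \<Rightarrow> nat \<Rightarrow> (nat \<Rightarrow> real) \<Rightarrow> nat \<Rightarrow> real" where
  "sorted_p_value \<gamma> n x i = sort (map (\<lambda>j. p_value \<gamma> (x j)) [1..<Suc n]) ! (i - 1)"

text \<open>If \<open>\<alpha>0 * n < 1\<close>, the index set is empty and the value is an unspecified constant.\<close>

definition HC :: "real \<Rightarrow> real \<Rightarrow> nat \<Rightarrow> (nat \<Rightarrow> real) \<Rightarrow> real" where
  "HC \<gamma> \<alpha>0 n x =
     Max ((\<lambda>i. let p = sorted_p_value \<gamma> n x i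
               in sqrt (real n) * (real i / real n - p) / sqrt (p * (1 - p)))
          ` {i. 1 \<le> i \<and> real i \<le> \<alpha>0 * real n})"

text \<open>The level condition is only imposed on those \<open>n\<close> for which the statistic is
  a maximum over a nonempty set.\<close>

definition HC_critical_value :: "real \<Rightarrow> real \<Rightarrow> (nat \<Rightarrow> real \<Rightarrow> real) \<Rightarrow> bool" where
  "HC_critical_value \<gamma> \<alpha>0 h \<longleftrightarrow>
     (\<forall>n a. 1 \<le> \<alpha>0 * real n \<longrightarrow> 0 < a \<longrightarrow> a < 1 \<longrightarrow>
        \<P>(x in H0_law \<gamma> n. HC \<gamma> \<alpha>0 n x > h n a) \<le> a)"

definition tends_to_0_slowly_enough :: "(nat \<Rightarrow> real \<Rightarrow> real) \<Rightarrow> (nat \<Rightarrow> real) \<Rightarrow> bool" where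
  "tends_to_0_slowly_enough h \<alpha> \<longleftrightarrow>
     \<alpha> \<longlonglongrightarrow> 0 \<and>
     (\<lambda>n. h n (\<alpha> n)) \<sim>[sequentially] (\<lambda>n. sqrt (2 * ln (ln (real n))))"

definition HC_power ::
  "real \<Rightarrow> real \<Rightarrow> (nat \<Rightarrow> real \<Rightarrow> real) \<Rightarrow> (nat \<Rightarrow> real) \<Rightarrow> real \<Rightarrow> real \<Rightarrow> nat \<Rightarrow> real" where
  "HC_power \<gamma> \<alpha>0 h \<alpha> \<beta> r n =
     \<P>(x in H1_law \<gamma> \<beta> r n. HC \<gamma> \<alpha>0 n x > h n (\<alpha> n))"

text \<open>Here \<open>pow \<beta> r n\<close> is the probability of rejecting at sample size \<open>n\<close> under the
  alternative with parameters \<open>\<beta>\<close> and \<open>r\<close>.\<close>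

definition is_detection_boundary ::
  "(real \<Rightarrow> real \<Rightarrow> nat \<Rightarrow> real) \<Rightarrow> (real \<Rightarrow> real) \<Rightarrow> bool" where
  "is_detection_boundary pow \<rho> \<longleftrightarrow>
     (\<forall>\<beta> r. 1/2 < \<beta> \<longrightarrow> \<beta> < 1 \<longrightarrow> 0 < r \<longrightarrow> r < 1 \<longrightarrow>
        (r > \<rho> \<beta> \<longrightarrow> pow \<beta> r \<longlonglongrightarrow> 1) \<and>
        (r < \<rho> \<beta> \<longrightarrow> pow \<beta> r \<longlonglongrightarrow> 0))"

text \<open>For \<open>\<gamma> > 1\<close> the two formulas agree at \<open>\<beta> = 1 - 2 powr (- \<gamma> / (\<gamma> - 1))\<close>.\<close>

definition rho_star :: "real \<Rightarrow> real \<Rightarrow> real" where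
  "rho_star \<gamma> \<beta> =
     (if \<gamma> > 1 then
        if \<beta> \<le> 1 - 2 powr (- \<gamma> / (\<gamma> - 1))
        then (2 powr (1 / (\<gamma> - 1)) - 1) powr (\<gamma> - 1) * (\<beta> - 1/2)
        else (1 - (1 - \<beta>) powr (1 / \<gamma>)) powr \<gamma>
      else 2 * (\<beta> - 1/2))"

end

theory Submission
  imports Defs "HOL-Real_Asymp.Real_Asymp"
begin

text \<open>
  Write \<open>T = (\<gamma> log n) powr (1/\<gamma>)\<close> and \<open>s = r powr (1/\<gamma>)\<close>, so that \<open>\<mu>\<^sub>n = s T\<close> and the null density at \<open>u T\<close>
  is proportional to \<open>n powr - (u powr \<gamma>)\<close>.

  Above the boundary some \<open>u \<in> [s, 1]\<close> satisfies \<open>\<beta> < (1 + u powr \<gamma>) / 2 - (u - s) powr \<gamma>\<close>. For the p-value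
  \<open>t\<close> of the threshold \<open>u T\<close>, the excess of the expected number of p-values below \<open>t\<close> over its null value \<open>n t\<close>
  then exceeds its standard deviation by a power of \<open>n\<close>; by a Chernoff bound the higher criticism
  statistic is at least a power of \<open>n\<close> with probability tending to 1, whereas the critical value is of order
  \<open>sqrt (log log n)\<close>.

  Below the boundary no test succeeds: \<open>n\<close> times the squared Hellinger distance of a single observation
  under the two hypotheses tends to 0, because \<open>u powr \<gamma> - 2 \<bar>u - s\<bar> powr \<gamma> < 2 \<beta> - 1\<close> uniformly in \<open>u \<in> [0, 1]\<close>.
  Hence the power is at most twice the level plus a term tending to 0.
\<close>

section \<open>The generalized Gaussian distribution\<close>

lemma GN_density_pos: "0 < \<gamma> \<Longrightarrow> 0 < GN_density \<gamma> \<mu> x"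
  by (simp add: GN_density_def Gamma_real_pos)

lemma GN_density_nonneg: "0 < \<gamma> \<Longrightarrow> 0 \<le> GN_density \<gamma> \<mu> x"
  using GN_density_pos by (rule less_imp_le)

lemma GN_density_measurable [measurable]: "GN_density \<gamma> \<mu> \<in> borel_measurable borel"
  unfolding GN_density_def by measurable

lemma GN_density_shift: "GN_density \<gamma> \<mu> x = GN_density \<gamma> 0 (x - \<mu>)"
  by (simp add: GN_density_def)

text \<open>The substitution \<open>t = x powr \<gamma> / \<gamma>\<close> turns the Euler integral
  for \<open>Gamma (1 / \<gamma>)\<close> into this one, up to the factor
  \<open>\<gamma> powr (1 - 1 / \<gamma>)\<close>.\<close>

lemma has_integral_exp_powr:
  assumes "0 < (\<gamma>::real)"
  shows "((\<lambda>x. exp (- (x powr \<gamma>) / \<gamma>)) has_integral \<gamma> powr (1 / \<gamma> - 1) * Gamma (1 / \<gamma>)) {0<..}"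
proof -
  define F where "F = (\<lambda>t::real. t powr (1 / \<gamma> - 1) / exp t)"
  define g where "g = (\<lambda>x::real. x powr \<gamma> / \<gamma>)"
  have "(F has_integral Gamma (1 / \<gamma>)) {0..}"
    unfolding F_def by (rule Gamma_integral_real) (use assms in simp)
  \<comment> \<open>The endpoint 0 is a null set; on the open half-line the substitution is a
    differentiable bijection.\<close>
  hence "((\<lambda>t. if t \<in> {0<..} then F t else 0) has_integral Gamma (1 / \<gamma>)) {0..}"
    by (rule has_integral_spike [of "{0}", rotated 2]) auto
  hence F: "(F has_integral Gamma (1 / \<gamma>)) {0<..}"
    by (subst (asm) has_integral_restrict) auto
  have F_abs: "F absolutely_integrable_on {0<..}"
    by (rule nonnegative_absolutely_integrable_1) (use F in \<open>auto simp: F_def\<close>)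
  have img: "g ` {0<..} = {0<..}"
  proof (intro antisym subsetI)
    fix y :: real assume "y \<in> {0<..}"
    hence "y = g ((\<gamma> * y) powr (1 / \<gamma>))" "(\<gamma> * y) powr (1 / \<gamma>) \<in> {0<..}"
      using assms by (simp_all add: g_def powr_powr)
    thus "y \<in> g ` {0<..}" by blast
  qed (use assms in \<open>auto simp: g_def\<close>)
  have inj: "inj_on g {0<..}"
    by (rule inj_on_inverseI[of _ "\<lambda>y. (\<gamma> * y) powr (1 / \<gamma>)"])
       (use assms in \<open>simp add: g_def powr_powr\<close>)
  have der: "(g has_field_derivative x powr (\<gamma> - 1)) (at x within {0<..})" if "x \<in> {0<..}" for x
    unfolding g_def using that assms by (auto intro!: derivative_eq_intros)
  have eq: "\<bar>x powr (\<gamma> - 1)\<bar> * F (g x) = \<gamma> powr (1 - 1 / \<gamma>) * exp (- (x powr \<gamma>) / \<gamma>)"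
    if "x \<in> {0<..}" for x
  proof -
    have "(x powr \<gamma>) powr (1 / \<gamma> - 1) = x powr (1 - \<gamma>)"
      using assms by (simp add: powr_powr algebra_simps)
    moreover have "x powr (\<gamma> - 1) * x powr (1 - \<gamma>) = 1"
      using that by (simp flip: powr_add)
    moreover have "inverse (\<gamma> powr (1 / \<gamma> - 1)) = \<gamma> powr (1 - 1 / \<gamma>)"
      by (simp flip: powr_minus)
    ultimately show ?thesis
      using that assms by (simp add: F_def g_def powr_divide exp_minus field_simps)
  qed
  have "(\<lambda>x. \<bar>x powr (\<gamma> - 1)\<bar> * F (g x)) absolutely_integrable_on {0<..} \<and>
           integral {0<..} (\<lambda>x. \<bar>x powr (\<gamma> - 1)\<bar> * F (g x)) = Gamma (1 / \<gamma>)"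
    by (subst has_absolute_integral_change_of_variables_1'[OF _ der inj])
       (use F F_abs img in \<open>auto simp: has_integral_iff\<close>)
  hence "((\<lambda>x. \<bar>x powr (\<gamma> - 1)\<bar> * F (g x)) has_integral Gamma (1 / \<gamma>)) {0<..}"
    by (auto simp: has_integral_iff set_lebesgue_integral_eq_integral)
  hence "((\<lambda>x. \<gamma> powr (1 - 1 / \<gamma>) * exp (- (x powr \<gamma>) / \<gamma>)) has_integral Gamma (1 / \<gamma>)) {0<..}"
    by (rule has_integral_eq[rotated]) (rule eq)
  from has_integral_mult_right[OF this, of "\<gamma> powr (1 / \<gamma> - 1)"]
  have "((\<lambda>x. (\<gamma> powr (1 / \<gamma> - 1) * \<gamma> powr (1 - 1 / \<gamma>)) * exp (- (x powr \<gamma>) / \<gamma>))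
      has_integral \<gamma> powr (1 / \<gamma> - 1) * Gamma (1 / \<gamma>)) {0<..}"
    by (simp only: mult.assoc)
  moreover have "\<gamma> powr (1 / \<gamma> - 1) * \<gamma> powr (1 - 1 / \<gamma>) = 1"
    using assms by (simp flip: powr_add)
  ultimately show ?thesis by simp
qed

text \<open>Each half-line carries mass 1/2; the factor 2 in the normalising constant accounts for
  the two sides.\<close>

lemma nn_integral_GN_density_0:
  assumes "0 < (\<gamma>::real)"
  shows "(\<integral>\<^sup>+x. ennreal (GN_density \<gamma> 0 x) \<partial>lborel) = 1"
proof -
  define C where "C = 2 * Gamma (1 / \<gamma>) * \<gamma> powr (1 / \<gamma> - 1)"
  have C: "0 < C" using assms by (simp add: C_def Gamma_real_pos)
  have "((\<lambda>x. exp (- (x powr \<gamma>) / \<gamma>) / C) has_integral (C / 2) / C) {0<..}"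
    using has_integral_divide[OF has_integral_exp_powr[OF assms], of C] by (simp add: C_def mult_ac)
  moreover have "GN_density \<gamma> 0 x = exp (- (x powr \<gamma>) / \<gamma>) / C" if "x \<in> {0<..}" for x
    using that by (simp add: GN_density_def C_def)
  ultimately have "(GN_density \<gamma> 0 has_integral 1/2) {0<..}"
    using C has_integral_cong[of "{0<..}" "GN_density \<gamma> 0" "\<lambda>x. exp (- (x powr \<gamma>) / \<gamma>) / C" "1/2"]
    by simp
  hence half: "(\<integral>\<^sup>+x. ennreal (indicator {0<..} x * GN_density \<gamma> 0 x) \<partial>lborel) = ennreal (1/2)"
    by (rule nn_integral_has_integral_lebesgue[rotated]) (rule GN_density_nonneg[OF assms])
  \<comment> \<open>The density is even, so the reflection \<open>x \<mapsto> - x\<close> exchanges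
    the two half-lines.\<close>
  have "(\<integral>\<^sup>+x. ennreal (indicator {..<0} x * GN_density \<gamma> 0 x) \<partial>lborel)
      = (\<integral>\<^sup>+x. ennreal (indicator {0<..} x * GN_density \<gamma> 0 x) \<partial>lborel)"
    by (subst nn_integral_real_affine[where c = "-1" and t = 0])
       (auto intro!: nn_integral_cong simp: GN_density_def indicator_def)
  with half have half': "(\<integral>\<^sup>+x. ennreal (indicator {..<0} x * GN_density \<gamma> 0 x) \<partial>lborel) = ennreal (1/2)"
    by simp
  have "AE x in lborel. ennreal (GN_density \<gamma> 0 x) =
      ennreal (indicator {0<..} x * GN_density \<gamma> 0 x) + ennreal (indicator {..<0} x * GN_density \<gamma> 0 x)"
    using AE_lborel_singleton[of 0] by eventually_elim (auto simp: indicator_def)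
  hence "(\<integral>\<^sup>+x. ennreal (GN_density \<gamma> 0 x) \<partial>lborel) =
        (\<integral>\<^sup>+x. ennreal (indicator {0<..} x * GN_density \<gamma> 0 x) + ennreal (indicator {..<0} x * GN_density \<gamma> 0 x) \<partial>lborel)"
    by (rule nn_integral_cong_AE)
  also have "\<dots> = ennreal (1/2) + ennreal (1/2)"
    by (subst nn_integral_add) (auto simp only: half half', measurable)
  also have "\<dots> = 1" using ennreal_plus[of "1/2" "1/2"] by simp
  finally show ?thesis .
qed

lemma nn_integral_GN_density:
  assumes "0 < (\<gamma>::real)"
  shows "(\<integral>\<^sup>+x. ennreal (GN_density \<gamma> \<mu> x) \<partial>lborel) = 1"
  using nn_integral_GN_density_0[OF assms]
  by (subst nn_integral_real_affine[where c = 1 and t = \<mu>]) (auto simp: GN_density_shift[of \<gamma> \<mu>])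

lemma GN_density_has_integral:
  assumes "0 < (\<gamma>::real)"
  shows "has_bochner_integral lborel (GN_density \<gamma> \<mu>) 1"
  by (rule has_bochner_integral_nn_integral)
     (auto simp: nn_integral_GN_density[OF assms] GN_density_nonneg[OF assms])

lemma GN_density_integrable [simp]: "0 < \<gamma> \<Longrightarrow> integrable lborel (GN_density \<gamma> \<mu>)"
  using GN_density_has_integral by (blast intro: has_bochner_integral_iff[THEN iffD1, THEN conjunct1])

lemma prob_space_GN: "0 < \<gamma> \<Longrightarrow> prob_space (GN \<gamma> \<mu>)"
  unfolding GN_def by (rule prob_spaceI) (simp add: emeasure_density nn_integral_GN_density)

lemma space_GN [simp]: "space (GN \<gamma> \<mu>) = UNIV" and sets_GN [measurable_cong, simp]: "sets (GN \<gamma> \<mu>) = sets borel"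
  by (simp_all add: GN_def)

lemma measure_GN:
  assumes "0 < \<gamma>" "A \<in> sets borel"
  shows "measure (GN \<gamma> \<mu>) A = (\<integral>x. indicator A x * GN_density \<gamma> \<mu> x \<partial>lborel)"
proof -
  have "emeasure (GN \<gamma> \<mu>) A = (\<integral>\<^sup>+x. ennreal (indicator A x * GN_density \<gamma> \<mu> x) \<partial>lborel)"
    unfolding GN_def using assms
    by (subst emeasure_density) (auto intro!: nn_integral_cong simp: indicator_def)
  thus ?thesis using assms
    by (subst integral_eq_nn_integral) (auto simp: measure_def GN_density_nonneg)
qed

lemma GN_density_indicator_integrable [simp]:
  assumes "0 < \<gamma>" "A \<in> sets borel"
  shows "integrable lborel (\<lambda>x. indicator A x * GN_density \<gamma> \<mu> x)"
  using integrable_mult_indicator[of A lborel "GN_density \<gamma> \<mu>"] assms by simp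

text \<open>Reduces the tail of the signal component to the null tail, so that the bounds on
  \<open>p_value\<close> serve both components of the mixture.\<close>

lemma measure_GN_shift:
  assumes "0 < \<gamma>"
  shows "measure (GN \<gamma> \<mu>) {x<..} = p_value \<gamma> (x - \<mu>)"
  unfolding p_value_def using assms
  by (simp add: measure_GN, subst lborel_integral_real_affine[where c = 1 and t = \<mu>])
     (auto intro!: Bochner_Integration.integral_cong simp: GN_density_shift[of \<gamma> \<mu>] indicator_def)

section \<open>The mixture law\<close>

lemma space_GN_mixture [simp]: "space (GN_mixture \<gamma> \<epsilon> \<mu>) = UNIV"
  and sets_GN_mixture [measurable_cong, simp]: "sets (GN_mixture \<gamma> \<epsilon> \<mu>) = sets borel"
  by (simp_all add: GN_mixture_def)

lemma prob_space_GN_mixture: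
  assumes "0 < \<gamma>" "0 \<le> \<epsilon>" "\<epsilon> \<le> 1"
  shows "prob_space (GN_mixture \<gamma> \<epsilon> \<mu>)"
proof (rule prob_spaceI)
  have "emeasure (GN_mixture \<gamma> \<epsilon> \<mu>) (space (GN_mixture \<gamma> \<epsilon> \<mu>)) =
     (\<integral>\<^sup>+x. ennreal (1-\<epsilon>) * ennreal (GN_density \<gamma> 0 x) + ennreal \<epsilon> * ennreal (GN_density \<gamma> \<mu> x) \<partial>lborel)"
    using assms
    by (auto simp: GN_mixture_def emeasure_density GN_density_nonneg
          simp flip: ennreal_mult ennreal_plus intro!: nn_integral_cong)
  also have "\<dots> = ennreal (1 - \<epsilon>) + ennreal \<epsilon>"
    by (subst nn_integral_add) (auto simp: nn_integral_cmult nn_integral_GN_density assms)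
  also have "\<dots> = 1" using assms by (simp flip: ennreal_plus)
  finally show "emeasure (GN_mixture \<gamma> \<epsilon> \<mu>) (space (GN_mixture \<gamma> \<epsilon> \<mu>)) = 1" .
qed

lemma measure_GN_mixture:
  assumes "0 < \<gamma>" "0 \<le> \<epsilon>" "\<epsilon> \<le> 1" "A \<in> sets borel"
  shows "measure (GN_mixture \<gamma> \<epsilon> \<mu>) A = (1 - \<epsilon>) * measure (GN \<gamma> 0) A + \<epsilon> * measure (GN \<gamma> \<mu>) A"
proof -
  let ?f = "\<lambda>x. (1 - \<epsilon>) * (indicator A x * GN_density \<gamma> 0 x) + \<epsilon> * (indicator A x * GN_density \<gamma> \<mu> x)"
  have "emeasure (GN_mixture \<gamma> \<epsilon> \<mu>) A = (\<integral>\<^sup>+x. ennreal (?f x) \<partial>lborel)"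
    unfolding GN_mixture_def using assms
    by (subst emeasure_density) (auto intro!: nn_integral_cong simp: indicator_def)
  hence "measure (GN_mixture \<gamma> \<epsilon> \<mu>) A = (\<integral>x. ?f x \<partial>lborel)"
    using assms by (subst integral_eq_nn_integral) (auto simp: measure_def GN_density_nonneg)
  thus ?thesis using assms by (simp add: measure_GN)
qed

section \<open>Tail bounds for the null law\<close>

lemma p_value_integral:
  "0 < \<gamma> \<Longrightarrow> p_value \<gamma> y = (\<integral>x. indicator {y<..} x * GN_density \<gamma> 0 x \<partial>lborel)"
  unfolding p_value_def by (rule measure_GN) auto

text \<open>The density decreases on the positive half-line, so the mass of \<open>{y<..y+1}\<close>
  is at least the density at its right end. The shift by 1 is negligible against thresholds that
  tend to infinity.\<close>

lemma p_value_ge_density: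
  assumes "0 < \<gamma>" "0 \<le> y"
  shows "GN_density \<gamma> 0 (y + 1) \<le> p_value \<gamma> y"
proof -
  have "GN_density \<gamma> 0 (y + 1) = (\<integral>x. indicator {y<..y+1} x * GN_density \<gamma> 0 (y + 1) \<partial>lborel)"
    by simp
  also have "\<dots> \<le> (\<integral>x. indicator {y<..} x * GN_density \<gamma> 0 x \<partial>lborel)"
  proof (rule integral_mono)
    show "integrable lborel (\<lambda>x. indicator {y<..y+1} x * GN_density \<gamma> 0 (y + 1))" by simp
    show "integrable lborel (\<lambda>x. indicator {y<..} x * GN_density \<gamma> 0 x)" using assms by simp
    fix x :: real
    have "GN_density \<gamma> 0 (y + 1) \<le> GN_density \<gamma> 0 x" if "x \<in> {y<..y+1}"
      using that assms unfolding GN_density_def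
      by (intro divide_right_mono) (auto intro!: divide_right_mono powr_mono2 simp: Gamma_real_nonneg)
    thus "indicator {y<..y+1} x * GN_density \<gamma> 0 (y + 1) \<le> indicator {y<..} x * GN_density \<gamma> 0 x"
      using GN_density_nonneg[OF assms(1), of 0 x] by (auto simp: indicator_def)
  qed
  also have "\<dots> = p_value \<gamma> y" using assms by (simp add: p_value_integral)
  finally show ?thesis .
qed

lemma p_value_antimono:
  assumes "0 < \<gamma>" "x \<le> y"
  shows "p_value \<gamma> y \<le> p_value \<gamma> x"
proof -
  interpret prob_space "GN \<gamma> 0" using assms by (intro prob_space_GN)
  show ?thesis unfolding p_value_def by (rule finite_measure_mono) (use assms in auto)
qed

lemma p_value_measurable [measurable]:
  assumes "0 < \<gamma>" shows "p_value \<gamma> \<in> borel_measurable borel"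
proof -
  have "(\<lambda>x. - p_value \<gamma> x) \<in> borel_measurable borel"
    by (rule borel_measurable_mono) (auto intro!: monoI p_value_antimono[OF assms])
  thus ?thesis by simp
qed

lemma p_value_pos:
  assumes "0 < \<gamma>" shows "0 < p_value \<gamma> x"
proof -
  have "0 < GN_density \<gamma> 0 (max 0 x + 1)" by (rule GN_density_pos[OF assms])
  also have "\<dots> \<le> p_value \<gamma> (max 0 x)" by (rule p_value_ge_density[OF assms]) simp
  also have "\<dots> \<le> p_value \<gamma> x" by (rule p_value_antimono[OF assms]) simp
  finally show ?thesis .
qed

lemma p_value_le_1:
  assumes "0 < \<gamma>" shows "p_value \<gamma> x \<le> 1"
proof -
  interpret prob_space "GN \<gamma> 0" using assms by (intro prob_space_GN)
  show ?thesis unfolding p_value_def by (rule prob_le_1)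
qed

text \<open>For \<open>x > y\<close> split \<open>x powr \<gamma>\<close> into the shares
  \<open>1 - \<delta>\<close> and \<open>\<delta>\<close>: the first is bounded below through
  \<open>y\<close>, the second leaves a rescaled density with finite integral. The loss of
  \<open>\<delta>\<close> in the exponent is affordable because the inequalities between exponents
  used later are strict.\<close>

lemma p_value_le_exp:
  assumes "0 < \<gamma>" "0 < \<delta>" "\<delta> < 1"
  obtains K where "0 < K" "\<And>y. 0 \<le> y \<Longrightarrow> p_value \<gamma> y \<le> K * exp (- (1 - \<delta>) * (y powr \<gamma> / \<gamma>))"
proof -
  define c where "c = \<delta> powr (1 / \<gamma>)"
  have c: "0 < c" "c powr \<gamma> = \<delta>" using assms by (auto simp: c_def powr_powr)
  have int: "integrable lborel (\<lambda>x. GN_density \<gamma> 0 (c * x))"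
    using lborel_integrable_real_affine[of "GN_density \<gamma> 0" c 0] assms c by simp
  define K where "K = (\<integral>x. GN_density \<gamma> 0 (c * x) \<partial>lborel)"
  have K: "0 \<le> K" unfolding K_def
    by (rule integral_nonneg_AE) (auto simp: GN_density_nonneg assms)
  \<comment> \<open>Adding 1 makes the constant strictly positive.\<close>
  have "p_value \<gamma> y \<le> (K + 1) * exp (- (1 - \<delta>) * (y powr \<gamma> / \<gamma>))" if "0 \<le> y" for y
  proof -
    let ?E = "exp (- (1 - \<delta>) * (y powr \<gamma> / \<gamma>))"
    have "p_value \<gamma> y \<le> (\<integral>x. ?E * GN_density \<gamma> 0 (c * x) \<partial>lborel)"
      unfolding p_value_integral[OF assms(1)]
    proof (rule integral_mono)
      show "integrable lborel (\<lambda>x. ?E * GN_density \<gamma> 0 (c * x))" using int by simp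
      fix x :: real
      have "indicator {y<..} x * GN_density \<gamma> 0 x \<le> ?E * GN_density \<gamma> 0 (c * x)" if "y < x"
      proof -
        have "y powr \<gamma> \<le> x powr \<gamma>" using that \<open>0 \<le> y\<close> assms by (intro powr_mono2) auto
        hence "(1 - \<delta>) * (y powr \<gamma> / \<gamma>) \<le> (1 - \<delta>) * (x powr \<gamma> / \<gamma>)"
          using assms by (intro mult_left_mono divide_right_mono) auto
        hence "- (x powr \<gamma> / \<gamma>) \<le> - (1 - \<delta>) * (y powr \<gamma> / \<gamma>) + - (\<delta> * (x powr \<gamma> / \<gamma>))"
          unfolding left_diff_distrib minus_mult_left[symmetric] by linarith
        hence "exp (- (x powr \<gamma> / \<gamma>)) \<le> ?E * exp (- (\<delta> * (x powr \<gamma> / \<gamma>)))"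
          unfolding exp_add[symmetric] exp_le_cancel_iff .
        moreover have "\<bar>c * x\<bar> powr \<gamma> = \<delta> * x powr \<gamma>"
          using that \<open>0 \<le> y\<close> c assms by (simp add: abs_mult powr_mult)
        ultimately show ?thesis using that \<open>0 \<le> y\<close> assms
          by (auto simp: GN_density_def intro!: divide_right_mono Gamma_real_nonneg)
      qed
      thus "indicator {y<..} x * GN_density \<gamma> 0 x \<le> ?E * GN_density \<gamma> 0 (c * x)"
        by (cases "y < x") (auto simp: GN_density_nonneg assms)
    qed (use assms in simp)
    also have "\<dots> = ?E * K" by (simp add: K_def)
    also have "\<dots> \<le> (K + 1) * ?E" by (simp add: algebra_simps)
    finally show ?thesis .
  qed
  with K that[of "K + 1"] show thesis by auto
qed

section \<open>The higher criticism statistic\<close>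

text \<open>Translates order statistics into counts, which are sums of indicators and hence open to
  measurability proofs and Chernoff bounds. Positions start at 0, whence the strict
  inequality.\<close>

lemma sort_nth_le_iff:
  fixes xs :: "'a::linorder list"
  assumes "k < length xs"
  shows "sort xs ! k \<le> c \<longleftrightarrow> k < length (filter (\<lambda>x. x \<le> c) xs)"
proof -
  define ys where "ys = sort xs"
  have ys: "sorted ys" "length ys = length xs" by (auto simp: ys_def)
  have len: "length (filter (\<lambda>x. x \<le> c) xs) = card {j. j < length ys \<and> ys ! j \<le> c}"
  proof -
    have "mset (filter (\<lambda>x. x \<le> c) ys) = mset (filter (\<lambda>x. x \<le> c) xs)" by (simp add: ys_def)
    hence "length (filter (\<lambda>x. x \<le> c) xs) = length (filter (\<lambda>x. x \<le> c) ys)" by (metis size_mset)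
    thus ?thesis by (simp add: length_filter_conv_card)
  qed
  have "k < card {j. j < length ys \<and> ys ! j \<le> c}" if "ys ! k \<le> c"
  proof -
    have "{..k} \<subseteq> {j. j < length ys \<and> ys ! j \<le> c}"
    proof
      fix j assume "j \<in> {..k}"
      with assms ys have "ys ! j \<le> ys ! k" "j < length ys" by (auto intro: sorted_nth_mono)
      with that show "j \<in> {j. j < length ys \<and> ys ! j \<le> c}" by simp
    qed
    from card_mono[OF _ this] show ?thesis by simp
  qed
  moreover have "ys ! k \<le> c" if "k < card {j. j < length ys \<and> ys ! j \<le> c}"
  proof (rule ccontr)
    assume "\<not> ys ! k \<le> c"
    have "{j. j < length ys \<and> ys ! j \<le> c} \<subseteq> {..<k}"
    proof (rule subsetI, rule ccontr)
      fix j assume "j \<in> {j. j < length ys \<and> ys ! j \<le> c}" "j \<notin> {..<k}"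
      moreover from this have "ys ! k \<le> ys ! j" using ys by (auto intro: sorted_nth_mono)
      ultimately have "ys ! k \<le> c" by (auto intro: order_trans)
      thus False using \<open>\<not> ys ! k \<le> c\<close> by contradiction
    qed
    from card_mono[OF _ this] that show False by simp
  qed
  ultimately show ?thesis by (auto simp: len ys_def)
qed

lemma sorted_p_value_le_iff:
  assumes "1 \<le> i" "i \<le> n"
  shows "sorted_p_value \<gamma> n x i \<le> c \<longleftrightarrow> i \<le> card {j \<in> {1..n}. p_value \<gamma> (x j) \<le> c}"
proof -
  let ?xs = "map (\<lambda>j. p_value \<gamma> (x j)) [1..<Suc n]"
  have "length (filter (\<lambda>p. p \<le> c) ?xs) = card ({j. p_value \<gamma> (x j) \<le> c} \<inter> {1..n})"
    by (simp only: filter_map length_map o_def distinct_length_filter distinct_upt set_upt atLeastLessThanSuc_atLeastAtMost)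
  moreover have "{j. p_value \<gamma> (x j) \<le> c} \<inter> {1..n} = {j \<in> {1..n}. p_value \<gamma> (x j) \<le> c}" by blast
  ultimately have len: "length (filter (\<lambda>p. p \<le> c) ?xs) = card {j \<in> {1..n}. p_value \<gamma> (x j) \<le> c}"
    by simp
  have "i - 1 < length ?xs" using assms by simp
  from sort_nth_le_iff[OF this, of c]
  have "sorted_p_value \<gamma> n x i \<le> c \<longleftrightarrow> i - 1 < card {j \<in> {1..n}. p_value \<gamma> (x j) \<le> c}"
    unfolding sorted_p_value_def len .
  thus ?thesis using assms(1) by linarith
qed

lemma sorted_p_value_pos:
  assumes "0 < \<gamma>" "1 \<le> i" "i \<le> n"
  shows "0 < sorted_p_value \<gamma> n x i"
proof -
  let ?xs = "map (\<lambda>j. p_value \<gamma> (x j)) [1..<Suc n]"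
  have "sort ?xs ! (i - 1) \<in> set (sort ?xs)" using assms by (intro nth_mem) simp
  thus ?thesis using p_value_pos[OF assms(1)] unfolding sorted_p_value_def by (auto simp del: upt_Suc)
qed

lemma finite_HC_index: "finite {i::nat. 1 \<le> i \<and> real i \<le> c}"
  by (rule finite_subset[of _ "{..nat \<lfloor>c\<rfloor>}"]) (auto simp: le_nat_floor)

text \<open>With \<open>k\<close> p-values up to \<open>t\<close>, the \<open>k\<close>-th smallest
  one \<open>p\<close> is at most \<open>t\<close>. Replacing \<open>p\<close> by \<open>t\<close>
  lowers the numerator, and \<open>p * (1 - p) \<le> t\<close> bounds the denominator. The bound
  \<open>1/2\<close> on \<open>t\<close> keeps \<open>p\<close> below 1, hence the denominator
  positive; \<open>t \<le> real k / real n\<close> keeps the numerator nonnegative.\<close>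

lemma HC_ge:
  assumes "0 < \<gamma>" "\<alpha>0 < 1" "1 \<le> k" "real k \<le> \<alpha>0 * real n"
    and "k \<le> card {j \<in> {1..n}. p_value \<gamma> (x j) \<le> t}" and "t \<le> 1/2" "t \<le> real k / real n"
  shows "sqrt (real n) * (real k / real n - t) / sqrt t \<le> HC \<gamma> \<alpha>0 n x"
proof -
  have "n > 0" using assms by (cases n) auto
  \<comment> \<open>The index must not exceed the length of the sorted list.\<close>
  have "real k \<le> 1 * real n" using assms by (intro order_trans[OF assms(4)] mult_right_mono) auto
  hence kn: "k \<le> n" by simp
  define p where "p = sorted_p_value \<gamma> n x k"
  have p: "0 < p" "p \<le> t"
    using sorted_p_value_pos[OF assms(1,3) kn] sorted_p_value_le_iff[OF assms(3) kn, of \<gamma> x t] assms(5)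
    by (auto simp: p_def)
  have "sqrt (real n) * (real k / real n - t) / sqrt t \<le> sqrt (real n) * (real k / real n - p) / sqrt (p * (1 - p))"
  proof (rule frac_le)
    have "p * (1 - p) \<le> t * 1" using p assms by (intro mult_mono) auto
    thus "sqrt (p * (1 - p)) \<le> sqrt t" by simp
    show "0 < sqrt (p * (1 - p))" using p assms by simp
    show "sqrt (real n) * (real k / real n - t) \<le> sqrt (real n) * (real k / real n - p)"
      using p by (intro mult_left_mono) auto
    show "0 \<le> sqrt (real n) * (real k / real n - p)" using p assms by simp
  qed
  also have "\<dots> \<le> HC \<gamma> \<alpha>0 n x"
    unfolding HC_def using assms by (intro Max_ge finite_imageI finite_HC_index) (auto simp: p_def Let_def)
  finally show ?thesis .
qed

lemma HC_measurable:
  assumes "0 < \<gamma>" "\<alpha>0 < 1" and [measurable_cong]: "\<And>i. sets (M i) = sets (borel :: real measure)"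
  shows "HC \<gamma> \<alpha>0 n \<in> borel_measurable (PiM {1..n} M)"
proof -
  have p [measurable]: "p_value \<gamma> \<in> borel_measurable borel" by (rule p_value_measurable[OF assms(1)])
  have sp: "(\<lambda>x. sorted_p_value \<gamma> n x i) \<in> borel_measurable (PiM {1..n} M)"
    if "1 \<le> i" "i \<le> n" for i
  proof (subst borel_measurable_iff_le, rule allI)
    fix c
    \<comment> \<open>Sublevel sets of an order statistic are events about a count, here written as
      a sum of indicators.\<close>
    have "(\<lambda>x. \<Sum>j\<in>{1..n}. if p_value \<gamma> (x j) \<le> c then 1 else 0 :: real) \<in> borel_measurable (PiM {1..n} M)"
      by measurable
    hence "{x \<in> space (PiM {1..n} M). real i \<le> (\<Sum>j\<in>{1..n}. if p_value \<gamma> (x j) \<le> c then 1 else 0)}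
        \<in> sets (PiM {1..n} M)" by measurable
    also have "{x \<in> space (PiM {1..n} M). real i \<le> (\<Sum>j\<in>{1..n}. if p_value \<gamma> (x j) \<le> c then 1 else 0)} =
        {x \<in> space (PiM {1..n} M). sorted_p_value \<gamma> n x i \<le> c}"
      using that by (simp add: sorted_p_value_le_iff sum.If_cases Int_def)
    finally show "{x \<in> space (PiM {1..n} M). sorted_p_value \<gamma> n x i \<le> c} \<in> sets (PiM {1..n} M)" .
  qed
  have "i \<le> n" if "real i \<le> \<alpha>0 * real n" for i
  proof -
    have "real i \<le> 1 * real n" using that assms by (intro order_trans[OF that] mult_right_mono) auto
    thus ?thesis by simp
  qed
  hence [measurable]: "(\<lambda>x. sorted_p_value \<gamma> n x i) \<in> borel_measurable (PiM {1..n} M)"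
    if "i \<in> {i. 1 \<le> i \<and> real i \<le> \<alpha>0 * real n}" for i
    using that sp by auto
  show ?thesis unfolding HC_def Let_def
    by (rule borel_measurable_Max[OF finite_HC_index], measurable)
qed

text \<open>Chernoff's method with \<open>l = D / (2 m)\<close>, the minimiser of \<open>m l\<^sup>2 - l D\<close>.\<close>
lemma prob_count_lower:
  assumes "prob_space M" "finite I" "A \<in> sets M" "0 < D" "0 < measure M A" "I \<noteq> {}"
  shows "measure (PiM I (\<lambda>_. M)) {x \<in> space (PiM I (\<lambda>_. M)). real (card {i \<in> I. x i \<in> A}) \<le> real (card I) * measure M A - D}
    \<le> exp (- (D\<^sup>2 / (4 * (real (card I) * measure M A))))"
proof -
  interpret M: prob_space M by fact
  interpret F: finite_product_prob_space "\<lambda>_. M" I by standard fact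
  let ?P = "PiM I (\<lambda>_. M)" and ?q = "measure M A"
  note [measurable] = assms(3)
  define m where "m = real (card I) * ?q"
  have m: "0 < m" using assms by (simp add: m_def card_gt_0_iff)
  define l where "l = D / (2 * m)"
  have l: "0 < l" using m assms by (simp add: l_def)
  define u where "u = (\<lambda>x. exp (- l * indicator A x))"
  have u_int: "integrable M u"
    by (rule M.integrable_const_bound[of _ 1]) (use l in \<open>auto simp: u_def indicator_def\<close>)
  \<comment> \<open>An indicator takes only the values 0 and 1, so its exponential is affine in it;
    this gives the mean of \<open>u\<close>.\<close>
  have u_eq: "u = (\<lambda>x. 1 - (1 - exp (- l)) * indicator A x)" by (auto simp: u_def indicator_def)
  have [simp]: "integrable M (indicator A :: _ \<Rightarrow> real)"
    by (rule M.integrable_const_bound[of _ 1]) (auto simp: indicator_def)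
  have Eu: "(\<integral>x. u x \<partial>M) = 1 - (1 - exp (- l)) * ?q"
    unfolding u_eq by (simp add: M.prob_space)
  define U where "U = (\<lambda>x. \<Prod>i\<in>I. u (x i))"
  have card_eq: "real (card {i \<in> I. x i \<in> A}) = (\<Sum>i\<in>I. indicator A (x i))" for x
    using assms(2) by (simp add: indicator_def sum.If_cases Int_def)
  have U_eq: "U x = exp (- l * real (card {i \<in> I. x i \<in> A}))" for x
    unfolding U_def u_def card_eq by (simp add: exp_sum[OF assms(2)] sum_distrib_left)
  have U_int: "integrable ?P U" unfolding U_def
    by (rule F.product_integrable_prod) (use assms u_int in auto)
  have "measure ?P {x \<in> space ?P. real (card {i \<in> I. x i \<in> A}) \<le> m - D}
      = measure ?P {x \<in> space ?P. exp (- l * (m - D)) \<le> U x}"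
    using l by (simp add: U_eq)
  \<comment> \<open>Markov's inequality for \<open>U\<close>, a decreasing function of the count
    whose mean factorises over the coordinates.\<close>
  also have "\<dots> \<le> (\<integral>x. U x \<partial>?P) / exp (- l * (m - D))"
    by (rule integral_Markov_inequality_measure[OF U_int, of "{}"]) (auto simp: U_eq)
  also have "(\<integral>x. U x \<partial>?P) = (1 - (1 - exp (- l)) * ?q) ^ card I" unfolding U_def
    using u_int assms(2) by (subst F.product_integral_prod) (auto simp: Eu)
  also have "\<dots> \<le> exp (- ((1 - exp (- l)) * ?q)) ^ card I"
  proof (rule power_mono)
    show "1 - (1 - exp (- l)) * ?q \<le> exp (- ((1 - exp (- l)) * ?q))"
      using exp_ge_add_one_self[of "- ((1 - exp (- l)) * ?q)"] by simp
    have "(1 - exp (- l)) * ?q \<le> 1 * 1" using l by (intro mult_mono) auto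
    thus "0 \<le> 1 - (1 - exp (- l)) * ?q" by simp
  qed
  also have "\<dots> = exp (- (m * (1 - exp (- l))))"
    by (simp add: m_def mult_ac flip: exp_of_nat_mult)
  also have "\<dots> \<le> exp (- (m * (l - l\<^sup>2)))"
  proof -
    have "exp (- l) \<le> 1 / (1 + l)"
      using l exp_ge_add_one_self[of l] by (simp add: exp_minus divide_simps)
    also have "1 / (1 + l) \<le> 1 - (l - l\<^sup>2)"
      using l by (simp add: field_simps power2_eq_square power3_eq_cube)
    finally show ?thesis using m by simp
  qed
  also have "exp (- (m * (l - l\<^sup>2))) / exp (- l * (m - D)) = exp (m * l\<^sup>2 - l * D)"
    by (simp add: exp_diff[symmetric] algebra_simps)
  also have "m * l\<^sup>2 - l * D = - (D\<^sup>2 / (4 * m))"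
    using m by (simp add: l_def power2_eq_square field_simps)
  finally show ?thesis by (simp add: m_def divide_right_mono)
qed

section \<open>Hellinger bound for product laws\<close>

text \<open>A product measure is determined by its values on boxes, and there Tonelli's theorem
  factorises the integral of the product density.\<close>

lemma PiM_density:
  assumes "prob_space M" "prob_space (density M g)" "finite I"
    and [measurable]: "g \<in> borel_measurable M"
  shows "PiM I (\<lambda>_. density M g) = density (PiM I (\<lambda>_. M)) (\<lambda>x. \<Prod>i\<in>I. g (x i))"
proof -
  interpret M: prob_space M by fact
  interpret Q: prob_space "density M g" by fact
  interpret F: finite_product_prob_space "\<lambda>_. M" I by standard fact
  interpret FQ: finite_product_prob_space "\<lambda>_. density M g" I by standard fact
  show ?thesis
  proof (rule FQ.PiM_eqI[symmetric])
    show "sets (density (PiM I (\<lambda>_. M)) (\<lambda>x. \<Prod>i\<in>I. g (x i))) = sets (PiM I (\<lambda>_. density M g))"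
      by (simp cong: sets_PiM_cong)
    fix A assume A: "\<And>i. i \<in> I \<Longrightarrow> A i \<in> sets (density M g)"
    hence A' [measurable]: "\<And>i. i \<in> I \<Longrightarrow> A i \<in> sets M" by simp
    have *: "PiE I A \<in> sets (PiM I (\<lambda>_. M))" by (rule sets_PiM_I_finite[OF assms(3) A'])
    \<comment> \<open>The product of the indicators ignores coordinates outside \<open>I\<close>;
      membership in the box also requires extensionality, which the space supplies.\<close>
    have ind: "indicator (PiE I A) x = (\<Prod>i\<in>I. indicator (A i) (x i) :: ennreal)"
      if "x \<in> space (PiM I (\<lambda>_. M))" for x
      using that assms(3) by (auto simp: indicator_def space_PiM PiE_iff prod_zero_iff)
    have "emeasure (density (PiM I (\<lambda>_. M)) (\<lambda>x. \<Prod>i\<in>I. g (x i))) (PiE I A)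
        = (\<integral>\<^sup>+x. (\<Prod>i\<in>I. g (x i)) * indicator (PiE I A) x \<partial>PiM I (\<lambda>_. M))"
      by (rule emeasure_density[OF _ *]) measurable
    also have "\<dots> = (\<integral>\<^sup>+x. (\<Prod>i\<in>I. g (x i) * indicator (A i) (x i)) \<partial>PiM I (\<lambda>_. M))"
      by (rule nn_integral_cong) (simp add: ind prod.distrib)
    also have "\<dots> = (\<Prod>i\<in>I. \<integral>\<^sup>+x. g x * indicator (A i) x \<partial>M)"
      by (rule F.product_nn_integral_prod) (use assms(3) in auto)
    also have "\<dots> = (\<Prod>i\<in>I. emeasure (density M g) (A i))"
      using A' by (intro prod.cong) (auto simp: emeasure_density)
    finally show "emeasure (density (PiM I (\<lambda>_. M)) (\<lambda>x. \<Prod>i\<in>I. g (x i))) (PiE I A)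
        = (\<Prod>i\<in>I. emeasure (density M g) (A i))" .
  qed fact
qed

text \<open>The likelihood ratio of the product laws is \<open>G = (1 + (sqrt G - 1))\<^sup>2 \<le> 2 + 2 (sqrt G - 1)\<^sup>2\<close>, and the
  Hellinger affinity \<open>\<integral> sqrt G\<close> is multiplicative.\<close>
lemma product_measure_le_Hellinger:
  fixes g :: "'a \<Rightarrow> real"
  assumes "prob_space M" "finite I" and nn: "\<And>x. 0 \<le> g x"
    and g: "has_bochner_integral M g 1" and A [measurable]: "A \<in> sets (PiM I (\<lambda>_. M))"
  shows "measure (PiM I (\<lambda>_. density M (\<lambda>x. ennreal (g x)))) A
    \<le> 2 * measure (PiM I (\<lambda>_. M)) A + 2 * real (card I) * (\<integral>x. (sqrt (g x) - 1)\<^sup>2 \<partial>M)"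
proof -
  interpret M: prob_space M by fact
  interpret F: finite_product_prob_space "\<lambda>_. M" I by standard fact
  let ?P = "PiM I (\<lambda>_. M)"
  have g_int [simp]: "integrable M g" and g1: "integral\<^sup>L M g = 1"
    using g by (auto simp: has_bochner_integral_iff)
  have [measurable]: "g \<in> borel_measurable M" using g_int by (rule borel_measurable_integrable)
  have Q: "prob_space (density M (\<lambda>x. ennreal (g x)))"
    by (rule prob_spaceI) (simp add: emeasure_density nn_integral_eq_integral nn g1)
  have sqrt_le: "sqrt y \<le> 1 + y" if "0 \<le> y" for y
    using that by (intro real_le_lsqrt) (auto simp: power2_eq_square algebra_simps)
  have s_int [simp]: "integrable M (\<lambda>x. sqrt (g x))"
    by (rule Bochner_Integration.integrable_bound[of _ "\<lambda>x. 1 + g x"]) (auto simp: nn sqrt_le)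
  define \<rho> where "\<rho> = (\<integral>x. sqrt (g x) \<partial>M)"
  have \<rho>: "0 \<le> \<rho>" unfolding \<rho>_def by (rule integral_nonneg_AE) (simp add: nn)
  have sq: "(sqrt y - 1)\<^sup>2 = y + 1 - 2 * sqrt y" if "0 \<le> y" for y
    using that by (simp add: power2_diff)
  have H: "(\<integral>x. (sqrt (g x) - 1)\<^sup>2 \<partial>M) = 2 - 2 * \<rho>"
    by (simp add: sq nn g1 \<rho>_def M.prob_space)
  define G where "G = (\<lambda>x. \<Prod>i\<in>I. g (x i))"
  have G_nn: "0 \<le> G x" for x unfolding G_def by (simp add: prod_nonneg nn)
  have sqrtG: "sqrt (G x) = (\<Prod>i\<in>I. sqrt (g (x i)))" for x
    unfolding G_def by (induction I rule: infinite_finite_induct) (auto simp: real_sqrt_mult)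
  have G_int [simp]: "integrable ?P G" and sG_int [simp]: "integrable ?P (\<lambda>x. sqrt (G x))"
    unfolding G_def sqrtG[unfolded G_def] by (rule F.product_integrable_prod; use assms(2) in simp)+
  have G1: "integral\<^sup>L ?P G = 1"
    unfolding G_def by (subst F.product_integral_prod) (use assms(2) in \<open>auto simp: g1\<close>)
  have sG: "(\<integral>x. sqrt (G x) \<partial>?P) = \<rho> ^ card I"
    unfolding sqrtG by (subst F.product_integral_prod) (use assms(2) in \<open>auto simp: \<rho>_def\<close>)
  have [measurable]: "G \<in> borel_measurable ?P" using G_int by (rule borel_measurable_integrable)
  have GA_int: "integrable ?P (\<lambda>x. indicator A x * G x)"
    using integrable_mult_indicator[OF A G_int] by simp
  have [simp]: "integrable ?P (indicator A :: _ \<Rightarrow> real)"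
    by (rule F.integrable_const_bound[of _ 1]) (auto simp: indicator_def)
  have "PiM I (\<lambda>_. density M (\<lambda>x. ennreal (g x))) = density ?P (\<lambda>x. ennreal (G x))"
    by (subst PiM_density) (use assms(1,2) Q in \<open>simp_all add: G_def prod_ennreal nn\<close>)
  hence "measure (PiM I (\<lambda>_. density M (\<lambda>x. ennreal (g x)))) A
      = enn2real (\<integral>\<^sup>+x. ennreal (indicator A x * G x) \<partial>?P)"
    by (simp add: measure_def emeasure_density mult.commute ennreal_mult G_nn ennreal_indicator)
  also have "\<dots> = (\<integral>x. indicator A x * G x \<partial>?P)"
    by (subst integral_eq_nn_integral) (auto simp: G_nn)
  also have "\<dots> \<le> (\<integral>x. 2 * indicator A x + 2 * (G x + 1 - 2 * sqrt (G x)) \<partial>?P)"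
  proof (rule integral_mono[OF GA_int])
    fix x
    \<comment> \<open>On \<open>A\<close> the claim rearranges to the first square being
      nonnegative, off \<open>A\<close> to the second.\<close>
    have "0 \<le> (sqrt (G x) - 2)\<^sup>2" "0 \<le> (sqrt (G x) - 1)\<^sup>2" by auto
    thus "indicator A x * G x \<le> 2 * indicator A x + 2 * (G x + 1 - 2 * sqrt (G x))"
      using G_nn[of x] by (auto simp: indicator_def power2_diff)
  qed auto
  also have "\<dots> = 2 * measure ?P A + 2 * (2 - 2 * \<rho> ^ card I)"
    by (simp add: G1 sG F.P.prob_space)
  also have "\<dots> \<le> 2 * measure ?P A + 2 * (real (card I) * (2 - 2 * \<rho>))"
    \<comment> \<open>Bernoulli's inequality makes \<open>1 - \<rho> ^ card I\<close> at most
      \<open>card I\<close> times \<open>1 - \<rho>\<close>.\<close>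
    using Bernoulli_inequality[of "\<rho> - 1" "card I"] \<rho> by (simp add: algebra_simps)
  finally show ?thesis by (simp add: H algebra_simps)
qed

section \<open>The exponents behind the detection boundary\<close>

text \<open>Convexity of the power at \<open>a / l\<close> and \<open>b / (1 - l)\<close> with
  weights \<open>l\<close> and \<open>1 - l\<close>. The weight stays free, to be tuned to the point
  where equality is wanted.\<close>

lemma powr_add_le_weighted:
  fixes \<gamma> a b l :: real
  assumes "1 \<le> \<gamma>" "0 < l" "l < 1" "0 < a" "0 \<le> b"
  shows "(a + b) powr \<gamma> \<le> l powr (1 - \<gamma>) * a powr \<gamma> + (1 - l) powr (1 - \<gamma>) * b powr \<gamma>"
proof (cases "b = 0")
  case True
  have "1 \<le> l powr (1 - \<gamma>)" using powr_mono2'[of "1 - \<gamma>" l 1] assms by simp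
  thus ?thesis using True assms by simp
next
  case False
  have "(l * (a / l) + (1 - l) * (b / (1 - l))) powr \<gamma> \<le> l * (a / l) powr \<gamma> + (1 - l) * (b / (1 - l)) powr \<gamma>"
    using convex_onD[OF powr_convex[OF assms(1)], of "1 - l" "a / l" "b / (1 - l)"] assms False by simp
  also have "l * (a / l) powr \<gamma> = l powr (1 - \<gamma>) * a powr \<gamma>"
    using assms by (simp add: powr_divide powr_diff)
  also have "(1 - l) * (b / (1 - l)) powr \<gamma> = (1 - l) powr (1 - \<gamma>) * b powr \<gamma>"
    using assms by (simp add: powr_divide powr_diff)
  finally show ?thesis using assms by simp
qed

text \<open>After scaling to \<open>a + b = 1\<close> it suffices that
  \<open>x \<le> x powr \<gamma>\<close> on the unit interval.\<close>

lemma powr_add_le_concave: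
  fixes \<gamma> a b :: real
  assumes "0 < \<gamma>" "\<gamma> \<le> 1" "0 \<le> a" "0 \<le> b"
  shows "(a + b) powr \<gamma> \<le> a powr \<gamma> + b powr \<gamma>"
proof (cases "a + b = 0")
  case False
  define c where "c = a + b"
  have c: "0 < c" using False assms by (simp add: c_def)
  have *: "x \<le> x powr \<gamma>" if "0 \<le> x" "x \<le> 1" for x :: real
    using powr_mono'[of \<gamma> 1 x] that assms by (cases "x = 0") auto
  have "c powr \<gamma> = c powr \<gamma> * (a / c + b / c)" using c by (simp add: c_def flip: add_divide_distrib)
  also have "\<dots> \<le> c powr \<gamma> * ((a / c) powr \<gamma> + (b / c) powr \<gamma>)"
    using c assms by (intro mult_left_mono add_mono *) (auto simp: c_def)
  also have "\<dots> = a powr \<gamma> + b powr \<gamma>"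
    using c assms by (simp add: powr_divide distrib_left)
  finally show ?thesis by (simp add: c_def)
qed (use assms in auto)

text \<open>The number \<open>A\<close> solves \<open>A powr (\<gamma> - 1) = 2\<close>, and the
  slope of the linear part of \<open>rho_star\<close> is \<open>(A - 1) powr (\<gamma> - 1)\<close>.
  The function \<open>u powr \<gamma> - 2 * \<bar>u - s\<bar> powr \<gamma>\<close> is maximal at
  \<open>u = s * (A / (A - 1))\<close>, which reaches 1 when \<open>s = 1 - 1 / A\<close>; there the
  two regimes of the boundary meet.\<close>

locale subbotin_exponents =
  fixes \<gamma> A :: real
  assumes \<gamma>: "1 < \<gamma>"
  defines "A \<equiv> 2 powr (1 / (\<gamma> - 1))"
begin

lemma A_gt_1: "1 < A"
  using \<gamma> by (simp add: A_def)

lemma A_powr: "A powr (\<gamma> - 1) = 2" "A powr (1 - \<gamma>) = 1/2" "A powr (- \<gamma>) = 1 / (2 * A)" "A powr \<gamma> = 2 * A"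
proof -
  show *: "A powr (\<gamma> - 1) = 2" using \<gamma> by (simp add: A_def powr_powr)
  show "A powr (1 - \<gamma>) = 1/2" using powr_minus[of A "\<gamma> - 1"] * by simp
  show **: "A powr \<gamma> = 2 * A" using powr_add[of A "\<gamma> - 1" 1] * A_gt_1 by simp
  show "A powr (- \<gamma>) = 1 / (2 * A)" by (simp add: powr_minus_divide **)
qed

lemma threshold_eq: "2 powr (- \<gamma> / (\<gamma> - 1)) = 1 / (2 * A)"
  using A_powr(3) by (simp add: A_def powr_powr)

lemma coefficient_eq: "((A - 1) / A) powr (1 - \<gamma>) = 2 * (A - 1) powr (1 - \<gamma>)"
  using A_gt_1 by (simp add: powr_divide A_powr)

lemma coefficient_inverse: "(A - 1) powr (1 - \<gamma>) * (A - 1) powr (\<gamma> - 1) = 1"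
  using A_gt_1 by (simp flip: powr_add)

lemma exponent_le:
  assumes "0 < s" "0 \<le> u"
  shows "u powr \<gamma> - 2 * \<bar>u - s\<bar> powr \<gamma> \<le> 2 * (A - 1) powr (1 - \<gamma>) * s powr \<gamma>"
proof -
  have "u powr \<gamma> \<le> (s + \<bar>u - s\<bar>) powr \<gamma>" using assms \<gamma> by (intro powr_mono2) auto
  \<comment> \<open>the weight is chosen to give \<open>\<bar>u - s\<bar> powr \<gamma>\<close> the coefficient 2\<close>
  also have "\<dots> \<le> ((A - 1) / A) powr (1 - \<gamma>) * s powr \<gamma> + (1 - (A - 1) / A) powr (1 - \<gamma>) * \<bar>u - s\<bar> powr \<gamma>"
    using \<gamma> assms A_gt_1 by (intro powr_add_le_weighted) auto
  also have "1 - (A - 1) / A = inverse A" using A_gt_1 by (simp add: field_simps)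
  also have "inverse A powr (1 - \<gamma>) = 2" using A_gt_1 A_powr by (simp add: inverse_powr flip: powr_minus)
  finally show ?thesis by (simp add: coefficient_eq)
qed

text \<open>For these \<open>s\<close> the unconstrained maximiser is at least 1, so on the unit
  interval the maximum sits at \<open>u = 1\<close>. When \<open>u\<close> is farther from
  \<open>s\<close> than 1 is, both terms compare directly; otherwise the weight \<open>s\<close> is
  used, for which the convexity bound is an equality at \<open>u = 1\<close>.\<close>

lemma exponent_le_1:
  assumes "1 - 1 / A \<le> s" "s < 1" "0 \<le> u" "u \<le> 1"
  shows "u powr \<gamma> - 2 * \<bar>u - s\<bar> powr \<gamma> \<le> 1 - 2 * (1 - s) powr \<gamma>"
proof (cases "\<bar>u - s\<bar> \<le> 1 - s")
  case False
  have "u powr \<gamma> \<le> 1 powr \<gamma>" "(1 - s) powr \<gamma> \<le> \<bar>u - s\<bar> powr \<gamma>"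
    using assms False \<gamma> by (intro powr_mono2; simp)+
  thus ?thesis by simp
next
  case True
  have s: "0 < s" using assms(1) A_gt_1 by (smt (verit) divide_less_eq_1)
  \<comment> \<open>This makes the net coefficient of \<open>\<bar>u - s\<bar> powr \<gamma>\<close>
    nonnegative, so that the bound increases with the distance to \<open>s\<close>.\<close>
  have "(1 / A) powr (1 - \<gamma>) \<le> (1 - s) powr (1 - \<gamma>)"
    using assms \<gamma> by (intro powr_mono2') auto
  moreover have "(1 / A) powr (1 - \<gamma>) = 2" using A_gt_1 by (simp add: powr_divide A_powr)
  ultimately have c: "2 \<le> (1 - s) powr (1 - \<gamma>)" by simp
  have "u powr \<gamma> \<le> (s + \<bar>u - s\<bar>) powr \<gamma>" using assms s \<gamma> by (intro powr_mono2) auto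
  also have "\<dots> \<le> s powr (1 - \<gamma>) * s powr \<gamma> + (1 - s) powr (1 - \<gamma>) * \<bar>u - s\<bar> powr \<gamma>"
    using \<gamma> s assms by (intro powr_add_le_weighted) auto
  also have "s powr (1 - \<gamma>) * s powr \<gamma> = s" using s by (simp flip: powr_add)
  finally have "u powr \<gamma> - 2 * \<bar>u - s\<bar> powr \<gamma> \<le> s + ((1 - s) powr (1 - \<gamma>) - 2) * \<bar>u - s\<bar> powr \<gamma>"
    by (simp add: algebra_simps)
  also have "\<dots> \<le> s + ((1 - s) powr (1 - \<gamma>) - 2) * (1 - s) powr \<gamma>"
    using c True \<gamma> by (intro add_left_mono mult_left_mono powr_mono2) auto
  also have "\<dots> = s + (1 - s) powr (1 - \<gamma>) * (1 - s) powr \<gamma> - 2 * (1 - s) powr \<gamma>"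
    by (simp add: algebra_simps)
  also have "(1 - s) powr (1 - \<gamma>) * (1 - s) powr \<gamma> = 1 - s"
    using assms by (simp flip: powr_add)
  finally show ?thesis by simp
qed

end

text \<open>At \<open>x = u (\<gamma> log n) powr (1/\<gamma>)\<close> the quantity \<open>n \<epsilon>\<^sup>2 f\<^sub>\<mu>\<^sup>2 / f\<^sub>0\<close> is of order \<open>n\<close> to the power
  \<open>1 - 2 \<beta> + u powr \<gamma> - 2 \<bar>u - s\<bar> powr \<gamma>\<close>, where \<open>s = r powr (1/\<gamma>)\<close> locates the signal on this scale.\<close>
lemma rho_star_undetectable:
  assumes "0 < \<gamma>" "1/2 < \<beta>" "\<beta> < 1" "0 < r" "r < 1" and r: "r < rho_star \<gamma> \<beta>"
  defines "s \<equiv> r powr (1 / \<gamma>)"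
  obtains \<kappa> where "\<kappa> < 2 * \<beta> - 1" "\<And>u. 0 \<le> u \<Longrightarrow> u \<le> 1 \<Longrightarrow> u powr \<gamma> - 2 * \<bar>u - s\<bar> powr \<gamma> \<le> \<kappa>"
proof -
  have s: "0 < s" "s < 1" "s powr \<gamma> = r"
    using assms powr_less_mono2[of "1 / \<gamma>" r 1] by (auto simp: s_def powr_powr)
  show thesis
  proof (cases "\<gamma> > 1")
    \<comment> \<open>For \<open>\<gamma> \<le> 1\<close> subadditivity suffices: one copy of
      \<open>\<bar>u - s\<bar> powr \<gamma>\<close> already brings the exponent down to
      \<open>r\<close>.\<close>
    case False
    have "u powr \<gamma> - 2 * \<bar>u - s\<bar> powr \<gamma> \<le> r" if "0 \<le> u" for u
    proof -
      have "u powr \<gamma> \<le> (s + \<bar>u - s\<bar>) powr \<gamma>" using assms s that by (intro powr_mono2) auto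
      also have "\<dots> \<le> s powr \<gamma> + \<bar>u - s\<bar> powr \<gamma>" using False assms s by (intro powr_add_le_concave) auto
      finally show ?thesis using s(3) powr_ge_zero[of "\<bar>u - s\<bar>" \<gamma>] by linarith
    qed
    moreover have "r < 2 * \<beta> - 1" using r False by (simp add: rho_star_def)
    ultimately show thesis using that by blast
  next
    case True
    define A where "A = 2 powr (1 / (\<gamma> - 1))"
    interpret subbotin_exponents \<gamma> A by unfold_locales (use True A_def in auto)
    note A1 = A_gt_1
    have rho: "rho_star \<gamma> \<beta> = (if \<beta> \<le> 1 - 1 / (2 * A) then (A - 1) powr (\<gamma> - 1) * (\<beta> - 1/2)
        else (1 - (1 - \<beta>) powr (1 / \<gamma>)) powr \<gamma>)"
      using True unfolding rho_star_def threshold_eq A_def[symmetric] by simp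
    have bnd: "u powr \<gamma> - 2 * \<bar>u - s\<bar> powr \<gamma> \<le> 2 * (A - 1) powr (1 - \<gamma>) * r" if "0 \<le> u" for u
      using exponent_le[of s u] s that by simp
    show thesis
    proof (cases "\<beta> \<le> 1 - 1 / (2 * A)")
      case le: True
      have "(A - 1) powr (1 - \<gamma>) * r < (A - 1) powr (1 - \<gamma>) * ((A - 1) powr (\<gamma> - 1) * (\<beta> - 1/2))"
        using r le A1 by (intro mult_strict_left_mono) (auto simp: rho)
      also have "\<dots> = \<beta> - 1/2" by (simp add: coefficient_inverse flip: mult.assoc)
      finally have "2 * (A - 1) powr (1 - \<gamma>) * r < 2 * \<beta> - 1" by simp
      thus thesis using that bnd by blast
    next
      case gt: False
      define b where "b = (1 - \<beta>) powr (1 / \<gamma>)"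
      have b: "0 < b" "b < 1" "b powr \<gamma> = 1 - \<beta>"
        using assms powr_less_mono2[of "1 / \<gamma>" "1 - \<beta>" 1] by (auto simp: b_def powr_powr)
      have "s powr \<gamma> < (1 - b) powr \<gamma>" using r gt s by (simp add: rho b_def)
      hence sb: "s < 1 - b" using b s assms(1) by (meson not_le powr_mono2 less_imp_le diff_ge_0_iff_ge order_less_imp_le le_less_trans less_irrefl)
      show thesis
      proof (cases "1 - 1 / A \<le> s")
        case True
        have "b powr \<gamma> < (1 - s) powr \<gamma>" using b sb assms by (intro powr_less_mono2) auto
        hence "1 - 2 * (1 - s) powr \<gamma> < 2 * \<beta> - 1" using b by simp
        thus thesis using that exponent_le_1[OF True s(2)] by blast
      next
        \<comment> \<open>The unconstrained bound increases with \<open>s\<close> and equals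
          \<open>1 - 1 / A\<close> at \<open>s = 1 - 1 / A\<close>; in this range of
          \<open>\<beta>\<close> that is at most \<open>2 * \<beta> - 1\<close>.\<close>
        case False
        hence "s powr \<gamma> < ((A - 1) / A) powr \<gamma>" using s A1 True
          by (intro powr_less_mono2) (auto simp: diff_divide_distrib)
        hence "(A - 1) powr (1 - \<gamma>) * r < (A - 1) powr (1 - \<gamma>) * ((A - 1) / A) powr \<gamma>"
          using s A1 by (intro mult_strict_left_mono) auto
        also have "\<dots> = ((A - 1) powr (1 - \<gamma>) * (A - 1) powr \<gamma>) / (2 * A)"
          using A1 by (simp add: powr_divide A_powr)
        also have "(A - 1) powr (1 - \<gamma>) * (A - 1) powr \<gamma> = A - 1" using A1 by (simp flip: powr_add)
        finally have "2 * (A - 1) powr (1 - \<gamma>) * r < (A - 1) / A" by simp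
        also have "(A - 1) / A = 1 - 1 / A" using A1 by (simp add: diff_divide_distrib)
        also have "\<dots> \<le> 2 * \<beta> - 1" using gt by simp
        finally show thesis using that bnd by blast
      qed
    qed
  qed
qed

text \<open>Above the threshold \<open>u (\<gamma> log n) powr (1/\<gamma>)\<close> the expected
  null count has exponent \<open>1 - u powr \<gamma>\<close> and the expected signal count
  \<open>1 - \<beta> - (u - s) powr \<gamma>\<close>. The last inequality says that the second
  exceeds half the first, so that the signal beats the null fluctuation.\<close>

lemma rho_star_detectable:
  assumes "0 < \<gamma>" "1/2 < \<beta>" "\<beta> < 1" "0 < r" "r < 1" and r: "rho_star \<gamma> \<beta> < r"
  defines "s \<equiv> r powr (1 / \<gamma>)"
  obtains u where "s \<le> u" "u \<le> 1" "\<beta> < (1 + u powr \<gamma>) / 2 - (u - s) powr \<gamma>"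
proof -
  have s: "0 < s" "s < 1" "s powr \<gamma> = r"
    using assms powr_less_mono2[of "1 / \<gamma>" r 1] by (auto simp: s_def powr_powr)
  show thesis
  proof (cases "\<gamma> > 1")
    case False
    \<comment> \<open>For \<open>\<gamma> \<le> 1\<close> the threshold at the signal itself
      works.\<close>
    thus thesis using that[of s] r s assms(1) by (simp add: rho_star_def)
  next
    case True
    define A where "A = 2 powr (1 / (\<gamma> - 1))"
    interpret subbotin_exponents \<gamma> A by unfold_locales (use True A_def in auto)
    note A1 = A_gt_1
    have rho: "rho_star \<gamma> \<beta> = (if \<beta> \<le> 1 - 1 / (2 * A) then (A - 1) powr (\<gamma> - 1) * (\<beta> - 1/2)
        else (1 - (1 - \<beta>) powr (1 / \<gamma>)) powr \<gamma>)"
      using True unfolding rho_star_def threshold_eq A_def[symmetric] by simp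
    show thesis
    proof (cases "\<beta> \<le> 1 - 1 / (2 * A)")
      case le: True
      show thesis
      proof (cases "s * (A / (A - 1)) \<le> 1")
        case True
        \<comment> \<open>the maximiser of \<open>u powr \<gamma> / 2 - (u - s) powr \<gamma>\<close> over \<open>u \<ge> s\<close>\<close>
        define u where "u = s * (A / (A - 1))"
        have "s * 1 \<le> s * (A / (A - 1))" using s A1 by (intro mult_left_mono) auto
        hence u: "s \<le> u" by (simp add: u_def)
        have us: "u - s = s / (A - 1)" using A1 by (simp add: u_def field_simps)
        have inv: "(A - 1) / (A - 1) powr \<gamma> = (A - 1) powr (1 - \<gamma>)"
          using A1 by (simp add: powr_diff)
        have "u powr \<gamma> / 2 - (u - s) powr \<gamma> = (r * (2 * A) / (A - 1) powr \<gamma>) / 2 - r / (A - 1) powr \<gamma>"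
          unfolding us unfolding u_def using s A1 by (simp add: powr_mult powr_divide A_powr)
        also have "\<dots> = (A - 1) / (A - 1) powr \<gamma> * r"
          by (simp add: algebra_simps diff_divide_distrib)
        finally have eq: "u powr \<gamma> / 2 - (u - s) powr \<gamma> = (A - 1) powr (1 - \<gamma>) * r"
          unfolding inv by simp
        have "\<beta> - 1/2 = (A - 1) powr (1 - \<gamma>) * ((A - 1) powr (\<gamma> - 1) * (\<beta> - 1/2))"
          by (simp add: coefficient_inverse flip: mult.assoc)
        also have "\<dots> < (A - 1) powr (1 - \<gamma>) * r"
          using r le A1 by (intro mult_strict_left_mono) (auto simp: rho)
        finally have "\<beta> < (1 + u powr \<gamma>) / 2 - (u - s) powr \<gamma>"
          unfolding eq[symmetric] by (simp add: add_divide_distrib)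
        thus thesis using that u True u_def by auto
      next
        \<comment> \<open>The maximiser lies beyond 1, so the end point \<open>u = 1\<close> is
          taken.\<close>
        case False
        hence "1 - s < 1 / A" using A1 by (simp add: field_simps)
        hence "(1 - s) powr \<gamma> < (1 / A) powr \<gamma>" using s assms(1) by (intro powr_less_mono2) auto
        also have "\<dots> = 1 / (2 * A)" using A1 by (simp add: powr_divide A_powr)
        finally show thesis using that[of 1] s le by simp
      qed
    next
      case gt: False
      \<comment> \<open>At \<open>u = 1\<close> the condition reads
        \<open>(1 - s) powr \<gamma> < 1 - \<beta>\<close>, that is,
        \<open>1 - b < s\<close>.\<close>
      define b where "b = (1 - \<beta>) powr (1 / \<gamma>)"
      have b: "0 < b" "b < 1" "b powr \<gamma> = 1 - \<beta>"
        using assms powr_less_mono2[of "1 / \<gamma>" "1 - \<beta>" 1] by (auto simp: b_def powr_powr)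
      have "(1 - b) powr \<gamma> < s powr \<gamma>" using r gt s by (simp add: rho b_def)
      hence "1 - b < s" using b s assms(1) by (meson not_le powr_mono2 less_imp_le le_less_trans less_irrefl)
      hence "(1 - s) powr \<gamma> < b powr \<gamma>" using s assms(1) by (intro powr_less_mono2) auto
      thus thesis using that[of 1] s b by simp
    qed
  qed
qed

section \<open>Below the boundary\<close>

lemma mixture_likelihood_ratio:
  assumes "0 < \<gamma>"
  shows "GN_density \<gamma> 0 x * (1 + \<epsilon> * (GN_density \<gamma> \<mu> x / GN_density \<gamma> 0 x - 1))
    = (1 - \<epsilon>) * GN_density \<gamma> 0 x + \<epsilon> * GN_density \<gamma> \<mu> x"
  using GN_density_pos[OF assms, of 0 x] by (simp add: field_simps)

lemma GN_mixture_eq_density: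
  assumes "0 < \<gamma>" "0 \<le> \<epsilon>" "\<epsilon> \<le> 1"
  shows "GN_mixture \<gamma> \<epsilon> \<mu> =
    density (GN \<gamma> 0) (\<lambda>x. ennreal (1 + \<epsilon> * (GN_density \<gamma> \<mu> x / GN_density \<gamma> 0 x - 1)))"
proof -
  show ?thesis unfolding GN_mixture_def GN_def mixture_likelihood_ratio[OF assms(1), symmetric]
    by (subst density_density_eq)
       (auto intro!: density_cong simp: GN_density_nonneg[OF assms(1)] simp flip: ennreal_mult')
qed

text \<open>With \<open>q = sqrt (1 + w)\<close> one has \<open>w = (q - 1) * (q + 1)\<close>, and
  \<open>q + 1\<close> dominates both 1 and \<open>\<bar>q - 1\<bar>\<close>.\<close>

lemma sqrt_1_plus_minus_1_sq:
  fixes w :: real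
  assumes "-1 \<le> w"
  shows "(sqrt (1 + w) - 1)\<^sup>2 \<le> w\<^sup>2" "(sqrt (1 + w) - 1)\<^sup>2 \<le> \<bar>w\<bar>"
proof -
  define q where "q = sqrt (1 + w)"
  have q: "0 \<le> q" "q\<^sup>2 = 1 + w" using assms by (auto simp: q_def)
  have w: "w = (q - 1) * (q + 1)" using q by (simp add: algebra_simps power2_eq_square)
  have "\<bar>q - 1\<bar> * 1 \<le> \<bar>q - 1\<bar> * (q + 1)" using q by (intro mult_left_mono) auto
  hence 1: "\<bar>q - 1\<bar> \<le> \<bar>w\<bar>" using q by (simp add: w abs_mult)
  thus "(sqrt (1 + w) - 1)\<^sup>2 \<le> w\<^sup>2" unfolding q_def[symmetric] by (simp add: abs_le_square_iff)
  have "\<bar>q - 1\<bar> * \<bar>q - 1\<bar> \<le> \<bar>q - 1\<bar> * (q + 1)" using q by (intro mult_left_mono) auto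
  thus "(sqrt (1 + w) - 1)\<^sup>2 \<le> \<bar>w\<bar>" unfolding q_def[symmetric]
    using q by (simp add: w abs_mult power2_eq_square)
qed

text \<open>With \<open>w = \<epsilon> (f\<^sub>\<mu> / f\<^sub>0 - 1)\<close>, the integrand \<open>(sqrt (1 + w) - 1)\<^sup>2\<close> is bounded by \<open>w\<^sup>2\<close> up to \<open>T\<close>
  and by \<open>\<bar>w\<bar>\<close> beyond \<open>T\<close>; left of 0 the likelihood ratio is at most 1.\<close>
lemma Hellinger_mixture_le:
  fixes \<gamma> \<epsilon> \<kappa> L s :: real
  assumes "0 < \<gamma>" "0 \<le> \<epsilon>" "\<epsilon> \<le> 1" "0 < L" "0 \<le> s"
    and \<kappa>: "\<And>u. 0 \<le> u \<Longrightarrow> u \<le> 1 \<Longrightarrow> u powr \<gamma> - 2 * \<bar>u - s\<bar> powr \<gamma> \<le> \<kappa>"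
  defines "T \<equiv> (\<gamma> * L) powr (1 / \<gamma>)"
  shows "(\<integral>x. (sqrt (1 + \<epsilon> * (GN_density \<gamma> (s * T) x / GN_density \<gamma> 0 x - 1)) - 1)\<^sup>2 \<partial>GN \<gamma> 0)
    \<le> 2 * \<epsilon>\<^sup>2 + \<epsilon>\<^sup>2 * (GN_density \<gamma> 0 0 * exp (\<kappa> * L) * T) + \<epsilon> * (p_value \<gamma> (T - s * T) + p_value \<gamma> T)"
proof -
  note \<gamma> = assms(1)
  have T: "0 < T" "T powr \<gamma> = \<gamma> * L" using assms by (auto simp: T_def powr_powr)
  define f0 where "f0 = GN_density \<gamma> 0"
  define f1 where "f1 = GN_density \<gamma> (s * T)"
  have pos: "0 < f0 x" "0 < f1 x" for x by (auto simp: f0_def f1_def GN_density_pos \<gamma>)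
  have [measurable]: "f0 \<in> borel_measurable borel" "f1 \<in> borel_measurable borel" by (auto simp: f0_def f1_def)
  define w where "w = (\<lambda>x. \<epsilon> * (f1 x / f0 x - 1))"
  have [measurable]: "w \<in> borel_measurable borel" unfolding w_def by measurable
  have w: "-1 \<le> w x" for x
  proof -
    have "\<epsilon> * (-1) \<le> w x" unfolding w_def using assms pos[of x] by (intro mult_left_mono) auto
    thus ?thesis using assms by simp
  qed
  have f0w: "f0 x * \<bar>w x\<bar> = \<epsilon> * \<bar>f1 x - f0 x\<bar>" for x
  proof -
    have "w x = \<epsilon> * ((f1 x - f0 x) / f0 x)" using pos[of x] by (simp add: w_def diff_divide_distrib)
    thus ?thesis using assms(2) pos[of x] by (simp add: abs_mult abs_divide)
  qed
  \<comment> \<open>An integrable majorant: the first term covers the left half-line and the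
    remainder on \<open>{0..T}\<close>, the second is constant there and integrates to a factor
    \<open>T\<close>, and the third is the tail.\<close>
  define b where "b = (\<lambda>x. 2 * \<epsilon>\<^sup>2 * f0 x + \<epsilon>\<^sup>2 * (f0 0 * exp (\<kappa> * L)) * indicator {0..T} x
    + \<epsilon> * (indicator {T<..} x * f1 x + indicator {T<..} x * f0 x))"
  have b: "f0 x * (sqrt (1 + w x) - 1)\<^sup>2 \<le> b x" for x
  proof -
    consider "x < 0" | "0 \<le> x" "x \<le> T" | "T < x" by linarith
    thus ?thesis
    proof cases
      case 1
      have "0 \<le> s * T" using assms T by (intro mult_nonneg_nonneg) auto
      \<comment> \<open>A negative point is at least as close to 0 as to the signal, so the
        likelihood ratio is at most 1.\<close>
      hence "\<bar>x\<bar> \<le> \<bar>x - s * T\<bar>" using 1 by linarith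
      hence "\<bar>x\<bar> powr \<gamma> \<le> \<bar>x - s * T\<bar> powr \<gamma>" using \<gamma> by (intro powr_mono2) auto
      hence "f1 x \<le> f0 x" unfolding f0_def f1_def GN_density_def using \<gamma>
        by (intro divide_right_mono) (auto intro!: divide_right_mono Gamma_real_nonneg)
      hence "f0 x * \<bar>w x\<bar> \<le> \<epsilon> * f0 x" unfolding f0w using pos[of x] assms by (intro mult_left_mono) auto
      hence "\<bar>w x\<bar> \<le> \<epsilon>" using pos[of x] by (simp add: mult.commute)
      hence "(w x)\<^sup>2 \<le> \<epsilon>\<^sup>2" using assms(2) by (simp add: abs_le_square_iff[symmetric])
      hence "f0 x * (sqrt (1 + w x) - 1)\<^sup>2 \<le> f0 x * \<epsilon>\<^sup>2"
        using sqrt_1_plus_minus_1_sq(1)[OF w[of x]] pos[of x] by (intro mult_left_mono) auto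
      also have "\<dots> \<le> b x" using 1 T pos[of x] by (simp add: b_def)
      finally show ?thesis .
    next
      case 2
      define u where "u = x / T"
      have u: "0 \<le> u" "u \<le> 1" "x = u * T" using 2 T by (auto simp: u_def)
      have "(f1 x)\<^sup>2 / f0 x = f0 0 * exp (L * (u powr \<gamma> - 2 * \<bar>u - s\<bar> powr \<gamma>))"
      proof -
        have "\<bar>x - s * T\<bar> powr \<gamma> = \<bar>u - s\<bar> powr \<gamma> * (\<gamma> * L)"
          unfolding T(2)[symmetric] using T by (simp add: u(3) abs_mult powr_mult flip: left_diff_distrib)
        moreover have "\<bar>x\<bar> powr \<gamma> = u powr \<gamma> * (\<gamma> * L)"
          unfolding T(2)[symmetric] using u T by (simp add: powr_mult)
        ultimately have f1: "f1 x = f0 0 * exp (- (L * \<bar>u - s\<bar> powr \<gamma>))" and f0: "f0 x = f0 0 * exp (- (L * u powr \<gamma>))"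
          using \<gamma> by (simp_all add: f0_def f1_def GN_density_def mult_ac)
        have "(f1 x)\<^sup>2 = f0 0 * exp (L * (u powr \<gamma> - 2 * \<bar>u - s\<bar> powr \<gamma>)) * f0 x"
          unfolding f1 f0 by (simp add: power2_eq_square algebra_simps flip: exp_add)
        thus ?thesis using pos[of x] by (simp add: field_simps)
      qed
      also have "\<dots> \<le> f0 0 * exp (\<kappa> * L)"
        using \<kappa>[OF u(1,2)] assms pos[of 0] by (simp add: mult.commute)
      finally have R: "(f1 x)\<^sup>2 / f0 x \<le> f0 0 * exp (\<kappa> * L)" .
      have "f0 x * (sqrt (1 + w x) - 1)\<^sup>2 \<le> f0 x * (w x)\<^sup>2"
        using sqrt_1_plus_minus_1_sq(1)[OF w[of x]] pos[of x] by (intro mult_left_mono) auto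
      also have "\<dots> = \<epsilon>\<^sup>2 * ((f1 x)\<^sup>2 / f0 x + f0 x - 2 * f1 x)"
        using pos[of x] by (simp add: w_def power2_eq_square field_simps)
      also have "\<dots> \<le> \<epsilon>\<^sup>2 * (f0 0 * exp (\<kappa> * L) + 2 * f0 x)"
        using R pos[of x] by (intro mult_left_mono) auto
      also have "\<dots> = b x" using 2 by (simp add: b_def algebra_simps)
      finally show ?thesis .
    next
      case 3
      have "f0 x * (sqrt (1 + w x) - 1)\<^sup>2 \<le> f0 x * \<bar>w x\<bar>"
        using sqrt_1_plus_minus_1_sq(2)[OF w[of x]] pos[of x] by (intro mult_left_mono) auto
      also have "\<dots> \<le> \<epsilon> * (f1 x + f0 x)"
        unfolding f0w using pos[of x] assms by (intro mult_left_mono) auto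
      also have "\<dots> \<le> b x" using 3 pos[of x] by (simp add: b_def)
      finally show ?thesis .
    qed
  qed
  have "has_bochner_integral lborel (indicator {0..T}) (measure lborel {0..T} :: real)"
    using T by (intro has_bochner_integral_real_indicator) auto
  hence ind: "has_bochner_integral lborel (indicator {0..T}) T" using T by simp
  have tail: "has_bochner_integral lborel (\<lambda>x. indicator {T<..} x * GN_density \<gamma> m x) (measure (GN \<gamma> m) {T<..})" for m
    using \<gamma> by (simp add: has_bochner_integral_iff measure_GN)
  have b_integral: "has_bochner_integral lborel b (2 * \<epsilon>\<^sup>2 * 1 + \<epsilon>\<^sup>2 * (f0 0 * exp (\<kappa> * L)) * T +
      \<epsilon> * (measure (GN \<gamma> (s * T)) {T<..} + measure (GN \<gamma> 0) {T<..}))"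
    unfolding b_def f0_def f1_def
    by (intro has_bochner_integral_add has_bochner_integral_mult_right ind tail GN_density_has_integral[OF \<gamma>])
  hence b_int: "integrable lborel b" by (simp add: has_bochner_integral_iff)
  have "(\<integral>x. (sqrt (1 + w x) - 1)\<^sup>2 \<partial>GN \<gamma> 0) = (\<integral>x. f0 x * (sqrt (1 + w x) - 1)\<^sup>2 \<partial>lborel)"
    unfolding GN_def f0_def[symmetric]
    by (subst integral_density) (use pos in \<open>auto intro: less_imp_le simp: f0_def\<close>)
  also have "\<dots> \<le> (\<integral>x. b x \<partial>lborel)"
  proof (rule integral_mono[OF _ b_int b])
    show "integrable lborel (\<lambda>x. f0 x * (sqrt (1 + w x) - 1)\<^sup>2)"
      using b pos by (intro Bochner_Integration.integrable_bound[OF b_int])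
        (auto simp: abs_mult less_imp_le intro!: order_trans[OF _ abs_ge_self])
  qed
  also have "\<dots> = 2 * \<epsilon>\<^sup>2 * 1 + \<epsilon>\<^sup>2 * (f0 0 * exp (\<kappa> * L)) * T +
      \<epsilon> * (measure (GN \<gamma> (s * T)) {T<..} + measure (GN \<gamma> 0) {T<..})"
    using b_integral by (rule has_bochner_integral_integral_eq)
  finally show ?thesis
    using \<gamma> by (simp add: w_def f0_def f1_def measure_GN_shift mult_ac)
qed

section \<open>From the Hellinger distance to the power\<close>

lemma sparsity_bounds: "0 < \<beta> \<Longrightarrow> 0 \<le> sparsity \<beta> n" "0 < \<beta> \<Longrightarrow> sparsity \<beta> n \<le> 1"
  \<comment> \<open>At \<open>n = 0\<close> the convention \<open>0 powr x = 0\<close> gives the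
    value 0.\<close>
  using powr_mono2'[of "-\<beta>" 1 "real n"] by (cases "n = 0"; simp add: sparsity_def)+

lemma signal_mean_eq:
  assumes "0 < \<gamma>" "0 < r" "0 < L" "L = ln (real n)"
  shows "signal_mean \<gamma> r n = r powr (1 / \<gamma>) * (\<gamma> * L) powr (1 / \<gamma>)"
  using assms by (simp add: signal_mean_def mult_ac flip: powr_mult)

lemma HC_exceed_measurable:
  assumes "0 < \<gamma>" "\<alpha>0 < 1" and M: "\<And>i. sets (M i) = sets (borel :: real measure)"
  shows "{x \<in> space (PiM {1..n} M). HC \<gamma> \<alpha>0 n x > c} \<in> sets (PiM {1..n} M)"
proof -
  have [measurable]: "HC \<gamma> \<alpha>0 n \<in> borel_measurable (PiM {1..n} M)" by (rule HC_measurable[OF assms])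
  show ?thesis by measurable
qed

lemma GN_mixture_density_integral:
  assumes "0 < \<gamma>"
  shows "has_bochner_integral (GN \<gamma> 0) (\<lambda>x. 1 + \<epsilon> * (GN_density \<gamma> \<mu> x / GN_density \<gamma> 0 x - 1)) 1"
proof -
  have "has_bochner_integral lborel (\<lambda>x. (1 - \<epsilon>) * GN_density \<gamma> 0 x + \<epsilon> * GN_density \<gamma> \<mu> x) ((1 - \<epsilon>) * 1 + \<epsilon> * 1)"
    by (intro has_bochner_integral_add has_bochner_integral_mult_right GN_density_has_integral assms)
  thus ?thesis unfolding GN_def has_bochner_integral_iff
    by (simp add: integrable_density integral_density GN_density_nonneg assms mixture_likelihood_ratio)
qed

text \<open>The Hellinger bound for product laws, applied to the rejection region.\<close>

lemma HC_power_le: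
  assumes "0 < \<gamma>" "\<alpha>0 < 1" "0 < \<beta>"
  shows "HC_power \<gamma> \<alpha>0 h \<alpha> \<beta> r n \<le> 2 * \<P>(x in H0_law \<gamma> n. HC \<gamma> \<alpha>0 n x > h n (\<alpha> n))
    + 2 * real n * (\<integral>x. (sqrt (1 + sparsity \<beta> n *
        (GN_density \<gamma> (signal_mean \<gamma> r n) x / GN_density \<gamma> 0 x - 1)) - 1)\<^sup>2 \<partial>GN \<gamma> 0)"
proof -
  define \<epsilon> where "\<epsilon> = sparsity \<beta> n"
  have \<epsilon>: "0 \<le> \<epsilon>" "\<epsilon> \<le> 1" using sparsity_bounds[OF assms(3)] by (auto simp: \<epsilon>_def)
  let ?g = "\<lambda>x. 1 + \<epsilon> * (GN_density \<gamma> (signal_mean \<gamma> r n) x / GN_density \<gamma> 0 x - 1)"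
  let ?E = "{x \<in> space (PiM {1..n} (\<lambda>_. GN \<gamma> 0)). HC \<gamma> \<alpha>0 n x > h n (\<alpha> n)}"
  have nn: "0 \<le> ?g x" for x
  proof -
    have "\<epsilon> * (-1) \<le> \<epsilon> * (GN_density \<gamma> (signal_mean \<gamma> r n) x / GN_density \<gamma> 0 x - 1)"
      using \<epsilon> GN_density_pos[OF assms(1)] by (intro mult_left_mono) (auto simp: less_imp_le)
    thus ?thesis using \<epsilon> by simp
  qed
  have E: "?E \<in> sets (PiM {1..n} (\<lambda>_. GN \<gamma> 0))"
    by (rule HC_exceed_measurable) (use assms in auto)
  have "H1_law \<gamma> \<beta> r n = PiM {1..n} (\<lambda>_. density (GN \<gamma> 0) (\<lambda>x. ennreal (?g x)))"
    unfolding H1_law_def \<epsilon>_def[symmetric] GN_mixture_eq_density[OF assms(1) \<epsilon>] ..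
  moreover have "{x \<in> space (H1_law \<gamma> \<beta> r n). HC \<gamma> \<alpha>0 n x > h n (\<alpha> n)} = ?E"
    by (simp add: H1_law_def space_PiM)
  ultimately have "HC_power \<gamma> \<alpha>0 h \<alpha> \<beta> r n = measure (PiM {1..n} (\<lambda>_. density (GN \<gamma> 0) (\<lambda>x. ennreal (?g x)))) ?E"
    by (simp add: HC_power_def)
  also have "\<dots> \<le> 2 * measure (PiM {1..n} (\<lambda>_. GN \<gamma> 0)) ?E + 2 * real (card {1..n}) * (\<integral>x. (sqrt (?g x) - 1)\<^sup>2 \<partial>GN \<gamma> 0)"
    by (rule product_measure_le_Hellinger[OF prob_space_GN _ nn GN_mixture_density_integral E]) (use assms in auto)
  finally show ?thesis by (simp add: H0_law_def \<epsilon>_def)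
qed

lemma Hellinger_tendsto_0:
  assumes "0 < \<gamma>" "1/2 < \<beta>" "\<beta> < 1" "0 < r" "r < 1" "r < rho_star \<gamma> \<beta>"
  shows "(\<lambda>n. real n * (\<integral>x. (sqrt (1 + sparsity \<beta> n *
        (GN_density \<gamma> (signal_mean \<gamma> r n) x / GN_density \<gamma> 0 x - 1)) - 1)\<^sup>2 \<partial>GN \<gamma> 0)) \<longlonglongrightarrow> 0"
    (is "(\<lambda>n. real n * ?H n) \<longlonglongrightarrow> 0")
proof -
  define s where "s = r powr (1 / \<gamma>)"
  have s: "0 < s" "s < 1"
    using assms powr_less_mono2[of "1 / \<gamma>" r 1] by (auto simp: s_def)
  obtain \<kappa> where \<kappa>: "\<kappa> < 2 * \<beta> - 1" "\<And>u. 0 \<le> u \<Longrightarrow> u \<le> 1 \<Longrightarrow> u powr \<gamma> - 2 * \<bar>u - s\<bar> powr \<gamma> \<le> \<kappa>"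
    using rho_star_undetectable[OF assms] unfolding s_def by blast
  \<comment> \<open>The signal tail beyond \<open>T\<close> has exponent \<open>d\<close>; the bound
    on \<open>\<kappa>\<close> at \<open>u = 1\<close> gives
    \<open>1 - 2 * d < 2 * \<beta> - 1\<close>, that is, \<open>1 - \<beta> < d\<close>.\<close>
  define d where "d = (1 - s) powr \<gamma>"
  have d: "1 - \<beta> < d" "d \<le> 1"
    using \<kappa>(1) \<kappa>(2)[of 1] s assms powr_mono2[of \<gamma> "1 - s" 1] by (auto simp: d_def)
  \<comment> \<open>The tail bound retains a share \<open>z < 1\<close> of the exponent;
    \<open>z\<close> is taken close enough to 1 to preserve
    \<open>1 - \<beta> < z * d\<close>.\<close>
  obtain z where z: "(1 - \<beta>) / d < z" "z < 1"
    using dense[of "(1 - \<beta>) / d" 1] d assms by (auto simp: field_simps)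
  have z0: "0 < z" using z(1) d assms by (smt (verit) divide_pos_pos)
  have zd: "1 - \<beta> < z * d" using z(1) d assms by (simp add: field_simps)
  have z1: "1 - \<beta> < z" using zd d z0 mult_left_le[of d z] by linarith
  obtain K where K: "0 < K" "\<And>y. 0 \<le> y \<Longrightarrow> p_value \<gamma> y \<le> K * exp (- z * (y powr \<gamma> / \<gamma>))"
    using p_value_le_exp[of \<gamma> "1 - z"] assms(1) z z0 by auto
  define F where "F = GN_density \<gamma> 0 0"
  \<comment> \<open>The terms of the Hellinger bound times \<open>n\<close>: a decaying power each,
    the second with a logarithmic factor from \<open>T\<close>.\<close>
  define B where "B = (\<lambda>n. 2 * real n powr (- (2 * \<beta> - 1))
     + F * (real n powr (- (2 * \<beta> - 1 - \<kappa>)) * (\<gamma> * ln (real n)) powr (1 / \<gamma>))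
     + K * real n powr (- (z * d - (1 - \<beta>))) + K * real n powr (- (z - (1 - \<beta>))))"
  have "B \<longlonglongrightarrow> 2 * 0 + F * 0 + K * 0 + K * 0"
  proof -
    have lim: "(\<lambda>n. real n powr (- c)) \<longlonglongrightarrow> 0" if "0 < c" for c using that by real_asymp
    have lim': "(\<lambda>n. real n powr (- c) * (\<gamma> * ln (real n)) powr (1 / \<gamma>)) \<longlonglongrightarrow> 0" if "0 < c" for c
      using that assms(1) by real_asymp
    show ?thesis unfolding B_def
      by (intro tendsto_add tendsto_mult tendsto_const lim lim') (use \<kappa>(1) assms zd z1 in auto)
  qed
  hence B: "B \<longlonglongrightarrow> 0" by simp
  have "real n * ?H n \<le> B n" if n: "2 \<le> n" for n
  proof -
    define L where "L = ln (real n)"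
    have L: "0 < L" using n by (simp add: L_def)
    define T where "T = (\<gamma> * L) powr (1 / \<gamma>)"
    have T: "0 < T" "T powr \<gamma> = \<gamma> * L" using assms(1) L by (auto simp: T_def powr_powr)
    have \<mu>: "signal_mean \<gamma> r n = s * T"
      using signal_mean_eq[OF assms(1,4) L L_def] by (simp add: s_def T_def)
    have n_powr: "real n powr c = exp (c * L)" for c using n by (simp add: powr_def L_def)
    have n_exp: "real n = exp L" using n by (simp add: L_def)
    have p1: "p_value \<gamma> (T - s * T) \<le> K * exp (- z * (d * L))"
    proof -
      have "(T - s * T) powr \<gamma> / \<gamma> = ((1 - s) * T) powr \<gamma> / \<gamma>" by (simp add: algebra_simps)
      also have "\<dots> = d * L" using T s assms(1) by (simp add: powr_mult d_def)
      finally show ?thesis using K(2)[of "T - s * T"] T s by simp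
    qed
    have p2: "p_value \<gamma> T \<le> K * exp (- z * L)" using K(2)[of T] T assms(1) by simp
    have "?H n \<le> 2 * (sparsity \<beta> n)\<^sup>2 + (sparsity \<beta> n)\<^sup>2 * (F * exp (\<kappa> * L) * T)
        + sparsity \<beta> n * (p_value \<gamma> (T - s * T) + p_value \<gamma> T)"
      unfolding \<mu> unfolding T_def F_def
      by (rule Hellinger_mixture_le) (use assms L s \<kappa>(2) sparsity_bounds[of \<beta> n] in auto)
    also have "\<dots> \<le> 2 * (sparsity \<beta> n)\<^sup>2 + (sparsity \<beta> n)\<^sup>2 * (F * exp (\<kappa> * L) * T)
        + sparsity \<beta> n * (K * exp (- z * (d * L)) + K * exp (- z * L))"
      using p1 p2 sparsity_bounds[of \<beta> n] assms(2) by (intro add_left_mono mult_left_mono add_mono) auto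
    finally have "real n * ?H n \<le> exp L * (2 * (exp (- \<beta> * L))\<^sup>2 + (exp (- \<beta> * L))\<^sup>2 * (F * exp (\<kappa> * L) * T)
        + exp (- \<beta> * L) * (K * exp (- z * (d * L)) + K * exp (- z * L)))"
      unfolding sparsity_def n_powr by (simp add: n_exp)
    also have "\<dots> = 2 * (exp L * exp (- \<beta> * L) * exp (- \<beta> * L))
       + F * (exp L * exp (- \<beta> * L) * exp (- \<beta> * L) * exp (\<kappa> * L) * T)
       + K * (exp L * exp (- \<beta> * L) * exp (- z * (d * L))) + K * (exp L * exp (- \<beta> * L) * exp (- z * L))"
      by (simp only: power2_eq_square distrib_left distrib_right mult_ac add_ac)
    also have "\<dots> = B n"
      unfolding B_def n_powr exp_add[symmetric] unfolding L_def[symmetric] T_def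
      by (simp add: algebra_simps)
    finally show ?thesis .
  qed
  hence up: "\<forall>\<^sub>F n in sequentially. real n * ?H n \<le> B n"
    using eventually_ge_at_top[of "2::nat"] by (rule eventually_mono[rotated])
  have low: "\<forall>\<^sub>F n in sequentially. 0 \<le> real n * ?H n"
    by (intro always_eventually allI mult_nonneg_nonneg integral_nonneg_AE) auto
  show ?thesis by (rule tendsto_sandwich[OF low up tendsto_const B])
qed

lemma HC_power_tendsto_0:
  assumes "0 < \<gamma>" "0 < \<alpha>0" "\<alpha>0 < 1" "HC_critical_value \<gamma> \<alpha>0 h" "\<And>n. 0 < \<alpha> n \<and> \<alpha> n < 1"
    and "tends_to_0_slowly_enough h \<alpha>"
    and "1/2 < \<beta>" "\<beta> < 1" "0 < r" "r < 1" "r < rho_star \<gamma> \<beta>"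
  shows "HC_power \<gamma> \<alpha>0 h \<alpha> \<beta> r \<longlonglongrightarrow> 0"
proof -
  let ?H = "\<lambda>n. (\<integral>x. (sqrt (1 + sparsity \<beta> n *
        (GN_density \<gamma> (signal_mean \<gamma> r n) x / GN_density \<gamma> 0 x - 1)) - 1)\<^sup>2 \<partial>GN \<gamma> 0)"
  have "(\<lambda>n. 2 * \<alpha> n + 2 * (real n * ?H n)) \<longlonglongrightarrow> 2 * 0 + 2 * 0"
    using assms(6) Hellinger_tendsto_0[OF assms(1,7-11)]
    by (intro tendsto_add tendsto_mult tendsto_const) (auto simp: tends_to_0_slowly_enough_def)
  hence lim: "(\<lambda>n. 2 * \<alpha> n + 2 * (real n * ?H n)) \<longlonglongrightarrow> 0" by simp
  \<comment> \<open>The level is controlled only once the index set of the maximum is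
    nonempty.\<close>
  have "filterlim (\<lambda>n. \<alpha>0 * real n) at_top sequentially" using assms(2) by real_asymp
  hence "\<forall>\<^sub>F n in sequentially. 1 \<le> \<alpha>0 * real n" by (simp add: filterlim_at_top)
  hence up: "\<forall>\<^sub>F n in sequentially. HC_power \<gamma> \<alpha>0 h \<alpha> \<beta> r n \<le> 2 * \<alpha> n + 2 * (real n * ?H n)"
  proof eventually_elim
    case (elim n)
    hence "\<P>(x in H0_law \<gamma> n. HC \<gamma> \<alpha>0 n x > h n (\<alpha> n)) \<le> \<alpha> n"
      using assms(4,5) unfolding HC_critical_value_def by blast
    with HC_power_le[of \<gamma> \<alpha>0 \<beta> h \<alpha> r n] show ?case using assms by simp
  qed
  have low: "\<forall>\<^sub>F n in sequentially. 0 \<le> HC_power \<gamma> \<alpha>0 h \<alpha> \<beta> r n"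
    by (simp add: HC_power_def)
  show ?thesis by (rule tendsto_sandwich[OF low up tendsto_const lim])
qed

section \<open>Above the boundary\<close>

text \<open>Here \<open>t\<close> and \<open>S\<close> are the probabilities that a null and a
  signal observation exceed \<open>y\<close>. By Chernoff's bound the number of exceedances stays
  above the null mean by at least half the expected excess, and then a single term of the maximum
  already exceeds \<open>c\<close>.\<close>

lemma prob_HC_exceeds_ge:
  fixes \<gamma> \<alpha>0 \<epsilon> \<mu> y c :: real and n :: nat
  defines "t \<equiv> p_value \<gamma> y" and "S \<equiv> p_value \<gamma> (y - \<mu>)"
  defines "Q \<equiv> PiM {1..n} (\<lambda>_. GN_mixture \<gamma> \<epsilon> \<mu>)"
  assumes "0 < \<gamma>" "\<alpha>0 < 1" "0 < n" "0 < \<epsilon>" "\<epsilon> \<le> 1"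
    and tS: "t \<le> S / 2" and size: "t + \<epsilon> + 1 / real n \<le> \<alpha>0" and t2: "t \<le> 1/2"
    and c: "c < sqrt (real n) * \<epsilon> * S / (4 * sqrt t)"
  shows "1 - exp (- (real n * \<epsilon>\<^sup>2 * S\<^sup>2 / (64 * (t + \<epsilon> * S)))) \<le> measure Q {x \<in> space Q. HC \<gamma> \<alpha>0 n x > c}"
proof -
  note \<gamma> = assms(4)
  have t: "0 < t" and S: "0 < S" "S \<le> 1" using \<gamma> by (auto simp: t_def S_def p_value_pos p_value_le_1)
  interpret M: prob_space "GN_mixture \<gamma> \<epsilon> \<mu>" using assms by (intro prob_space_GN_mixture) auto
  interpret F: finite_product_prob_space "\<lambda>_. GN_mixture \<gamma> \<epsilon> \<mu>" "{1..n}" by standard auto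
  define \<pi> where "\<pi> = measure (GN_mixture \<gamma> \<epsilon> \<mu>) {y<..}"
  have \<pi>: "\<pi> = t + \<epsilon> * (S - t)"
    using assms by (simp add: \<pi>_def measure_GN_mixture measure_GN_shift algebra_simps)
  \<comment> \<open>Half the expected excess, so that \<open>m\<close> is midway between the null
    mean \<open>n t\<close> and the alternative mean.\<close>
  define D where "D = real n * \<epsilon> * (S - t) / 2"
  define m where "m = real n * \<pi> - D"
  have m: "m = real n * t + D" by (simp add: m_def \<pi> D_def field_simps)
  have "real n * \<epsilon> * (S / 2) / 2 \<le> D"
    unfolding D_def using tS assms by (intro divide_right_mono mult_left_mono) auto
  hence D: "real n * \<epsilon> * S / 4 \<le> D" by simp
  have D0: "0 < D" using D assms S by (smt (verit) mult_pos_pos of_nat_0_less_iff divide_pos_pos)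
  have Dn: "D \<le> real n * \<epsilon>"
  proof -
    have "real n * \<epsilon> * ((S - t) / 2) \<le> real n * \<epsilon> * 1" using S t assms by (intro mult_left_mono) auto
    thus ?thesis by (simp add: D_def)
  qed
  have m0: "0 < m" using D0 t assms by (simp add: m add_nonneg_pos)
  have \<pi>0: "0 < \<pi>" using t tS assms by (auto simp: \<pi> intro!: add_pos_nonneg)
  have \<pi>_le: "\<pi> \<le> t + \<epsilon> * S" using t assms by (auto simp: \<pi> intro!: mult_left_mono)
  \<comment> \<open>A count above \<open>m\<close> is at least \<open>k\<close>, so the
    \<open>k\<close>-th term can be used; rounding costs at most \<open>1 / n\<close> in
    \<open>k / n\<close>.\<close>
  define k where "k = nat \<lceil>m\<rceil>"
  have k: "m \<le> real k" "real k \<le> m + 1" "1 \<le> k"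
    using m0 unfolding k_def by (auto simp: of_nat_ceiling) linarith+
  have k_le: "real k \<le> \<alpha>0 * real n"
  proof -
    have "real k \<le> (t + \<epsilon> + 1 / real n) * real n"
      using k(2) Dn assms(6) by (simp add: m algebra_simps)
    also have "\<dots> \<le> \<alpha>0 * real n" using size by (intro mult_right_mono) auto
    finally show ?thesis .
  qed
  have HC: "c < HC \<gamma> \<alpha>0 n x" if "m < real (card {i \<in> {1..n}. x i \<in> {y<..}})" for x
  proof -
    have "k \<le> card {i \<in> {1..n}. x i \<in> {y<..}}"
      unfolding k_def using that by (simp add: nat_le_iff ceiling_le_iff)
    also have "\<dots> \<le> card {i \<in> {1..n}. p_value \<gamma> (x i) \<le> t}"
      by (rule card_mono) (auto simp: t_def intro: p_value_antimono[OF \<gamma>])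
    finally have cnt: "k \<le> card {i \<in> {1..n}. p_value \<gamma> (x i) \<le> t}" .
    have kn: "D / real n \<le> real k / real n - t"
      using k(1) assms(6) by (simp add: m field_simps)
    have "sqrt (real n) * \<epsilon> * S / (4 * sqrt t) = sqrt (real n) * (\<epsilon> * S / 4) / sqrt t" by simp
    also have "\<dots> \<le> sqrt (real n) * (real k / real n - t) / sqrt t"
    proof (intro divide_right_mono mult_left_mono)
      have "\<epsilon> * S / 4 \<le> D / real n" using D assms(6) by (simp add: field_simps)
      thus "\<epsilon> * S / 4 \<le> real k / real n - t" using kn by linarith
    qed (use t in auto)
    also have "\<dots> \<le> HC \<gamma> \<alpha>0 n x"
    proof (rule HC_ge[OF \<gamma> assms(5) k(3) k_le cnt t2])
      have "0 \<le> D / real n" using D0 by simp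
      thus "t \<le> real k / real n" using kn by linarith
    qed
    finally show ?thesis using c by linarith
  qed
  have E: "{x \<in> space Q. HC \<gamma> \<alpha>0 n x > c} \<in> sets Q"
    unfolding Q_def by (rule HC_exceed_measurable) (use assms in auto)
  let ?B = "{x \<in> space Q. real (card {i \<in> {1..n}. x i \<in> {y<..}}) \<le> m}"
  have B: "?B \<in> sets Q"
  proof -
    have eq: "real (card {i \<in> {1..n}. x i \<in> {y<..}}) = (\<Sum>i\<in>{1..n}. if x i \<in> {y<..} then 1 else 0)" for x :: "nat \<Rightarrow> real"
      by (simp add: sum.If_cases Int_def)
    have "(\<lambda>x. \<Sum>i\<in>{1..n}. if x i \<in> {y<..} then 1 else 0 :: real) \<in> borel_measurable Q"
      unfolding Q_def by measurable
    thus ?thesis unfolding eq by measurable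
  qed
  have "measure Q ?B \<le> exp (- (D\<^sup>2 / (4 * (real n * \<pi>))))"
    using prob_count_lower[OF M.prob_space_axioms, of "{1..n}" "{y<..}" D] assms(6) D0 \<pi>0
    by (simp add: \<pi>_def[symmetric] m_def Q_def)
  also have "\<dots> \<le> exp (- (real n * \<epsilon>\<^sup>2 * S\<^sup>2 / (64 * (t + \<epsilon> * S))))"
  proof -
    have "real n * \<epsilon>\<^sup>2 * S\<^sup>2 / (64 * (t + \<epsilon> * S)) \<le> real n * \<epsilon>\<^sup>2 * S\<^sup>2 / (64 * \<pi>)"
      using \<pi>_le \<pi>0 assms by (intro divide_left_mono) auto
    also have "\<dots> = (real n * \<epsilon> * S / 4)\<^sup>2 / (4 * (real n * \<pi>))"
      using assms(6) \<pi>0 by (simp add: power2_eq_square field_simps)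
    also have "\<dots> \<le> D\<^sup>2 / (4 * (real n * \<pi>))"
      using D S \<pi>0 assms by (intro divide_right_mono power_mono) auto
    finally show ?thesis by simp
  qed
  finally have "1 - exp (- (real n * \<epsilon>\<^sup>2 * S\<^sup>2 / (64 * (t + \<epsilon> * S)))) \<le> 1 - measure Q ?B" by simp
  also have "\<dots> = measure Q (space Q - ?B)"
    using F.P.prob_compl[of ?B] B unfolding Q_def by simp
  also have "\<dots> \<le> measure Q {x \<in> space Q. HC \<gamma> \<alpha>0 n x > c}"
    unfolding Q_def by (rule F.P.finite_measure_mono) (use HC E in \<open>auto simp: Q_def\<close>)
  finally show ?thesis .
qed

text \<open>In units of \<open>T\<close> the shift by 1 in the density bound is
  \<open>1 / T\<close>, which tends to 0; the strict inequality \<open>v powr \<gamma> < b\<close>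
  absorbs it.\<close>

lemma p_value_ge_powr:
  fixes v :: real
  assumes "0 < \<gamma>" "0 \<le> v" "v powr \<gamma> < b"
  shows "\<forall>\<^sub>F n in sequentially.
    GN_density \<gamma> 0 0 * real n powr (- b) \<le> p_value \<gamma> (v * (\<gamma> * ln (real n)) powr (1 / \<gamma>))"
proof -
  define T where "T = (\<lambda>n. (\<gamma> * ln (real n)) powr (1 / \<gamma>))"
  have "(\<lambda>n. v + 1 / T n) \<longlonglongrightarrow> v + 0"
    unfolding T_def using assms(1) by (intro tendsto_add tendsto_const) real_asymp
  hence "(\<lambda>n. (v + 1 / T n) powr \<gamma>) \<longlonglongrightarrow> (v + 0) powr \<gamma>"
    \<comment> \<open>The value \<open>v = 0\<close> is allowed, since it occurs when the threshold
      sits at the signal.\<close>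
    using assms by (intro tendsto_powr') (auto simp: T_def)
  hence "\<forall>\<^sub>F n in sequentially. (v + 1 / T n) powr \<gamma> < b"
    using assms(3) by (auto dest: order_tendstoD(2))
  thus ?thesis using eventually_ge_at_top[of 2]
  proof eventually_elim
    case (elim n)
    hence L: "0 < ln (real n)" by simp
    have T: "0 < T n" "T n powr \<gamma> = \<gamma> * ln (real n)" using L assms(1) by (auto simp: T_def powr_powr)
    have "v * T n + 1 = (v + 1 / T n) * T n" using T by (simp add: field_simps)
    hence "(v * T n + 1) powr \<gamma> = (v + 1 / T n) powr \<gamma> * T n powr \<gamma>"
      using T assms by (simp add: powr_mult)
    hence eq: "(v * T n + 1) powr \<gamma> / \<gamma> = (v + 1 / T n) powr \<gamma> * ln (real n)" using T assms(1) by simp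
    have vT: "0 \<le> v * T n" using T assms by simp
    have "real n powr (- b) = exp (- (b * ln (real n)))" using elim by (simp add: powr_def)
    also have "\<dots> \<le> exp (- ((v * T n + 1) powr \<gamma> / \<gamma>))"
      unfolding eq using elim L by simp
    finally have "GN_density \<gamma> 0 0 * real n powr (- b) \<le> GN_density \<gamma> 0 0 * exp (- ((v * T n + 1) powr \<gamma> / \<gamma>))"
      by (intro mult_left_mono GN_density_nonneg assms(1))
    also have "\<dots> = GN_density \<gamma> 0 (v * T n + 1)" using vT assms(1) by (simp add: GN_density_def)
    also have "\<dots> \<le> p_value \<gamma> (v * T n)" by (rule p_value_ge_density[OF assms(1) vT])
    finally show ?case by (simp add: T_def)
  qed
qed

lemma slowly_enough_eventually_less:
  assumes "tends_to_0_slowly_enough h \<alpha>" "0 < e" "0 < (C::real)"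
  shows "\<forall>\<^sub>F n in sequentially. h n (\<alpha> n) < C * real n powr e"
proof -
  have "(\<lambda>n. h n (\<alpha> n)) \<sim>[sequentially] (\<lambda>n. sqrt (2 * ln (ln (real n))))"
    using assms(1) by (simp add: tends_to_0_slowly_enough_def)
  \<comment> \<open>Asymptotic equivalence reads \<open>0 / 0\<close> as 1; eventual positivity of
    the denominator removes that case.\<close>
  hence "\<forall>\<^sub>F n in sequentially. (if h n (\<alpha> n) = 0 \<and> sqrt (2 * ln (ln (real n))) = 0 then 1
      else h n (\<alpha> n) / sqrt (2 * ln (ln (real n)))) < 2"
    unfolding asymp_equiv_def by (rule order_tendstoD(2)) simp
  moreover have "\<forall>\<^sub>F n in sequentially. 0 < sqrt (2 * ln (ln (real n)))" by real_asymp
  moreover have "\<forall>\<^sub>F n in sequentially. 2 * sqrt (2 * ln (ln (real n))) < C * real n powr e"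
    using assms(2,3) by real_asymp
  ultimately show ?thesis
  proof eventually_elim
    case (elim n)
    hence "h n (\<alpha> n) / sqrt (2 * ln (ln (real n))) < 2" by auto
    hence "h n (\<alpha> n) < 2 * sqrt (2 * ln (ln (real n)))" using elim(2) by (simp only: pos_divide_less_eq)
    with elim(3) show ?case by linarith
  qed
qed

lemma HC_power_tendsto_1:
  assumes "0 < \<gamma>" "0 < \<alpha>0" "\<alpha>0 < 1" and slow: "tends_to_0_slowly_enough h \<alpha>"
    and "1/2 < \<beta>" "\<beta> < 1" "0 < r" "r < 1" "rho_star \<gamma> \<beta> < r"
  shows "HC_power \<gamma> \<alpha>0 h \<alpha> \<beta> r \<longlonglongrightarrow> 1"
proof -
  define s where "s = r powr (1 / \<gamma>)"
  have s: "0 < s" "s < 1"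
    using assms powr_less_mono2[of "1 / \<gamma>" r 1] by (auto simp: s_def)
  obtain u where u: "s \<le> u" "u \<le> 1" "\<beta> < (1 + u powr \<gamma>) / 2 - (u - s) powr \<gamma>"
    using rho_star_detectable[OF assms(1,5-9)] unfolding s_def by blast
  define q d where "q = u powr \<gamma>" and "d = (u - s) powr \<gamma>"
  have q: "0 < q" "q \<le> 1" and d: "0 \<le> d"
    using u s assms(1) powr_mono2[of \<gamma> u 1] by (auto simp: q_def d_def)
  \<comment> \<open>The slack in the detection condition. Choosing \<open>z\<close> costs at most
    \<open>g / 2\<close> in \<open>a\<close>, hence \<open>g / 4\<close> in \<open>a / 2\<close>,
    and \<open>b\<close> costs another \<open>g / 4\<close>, so \<open>e\<close> is at least
    \<open>g / 2\<close>.\<close>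
  define g where "g = (1 + q) / 2 - \<beta> - d"
  have g: "0 < g" "g < 1" using u(3) q d assms(5) unfolding q_def[symmetric] d_def[symmetric] g_def by argo+
  define z where "z = 1 - g / 2"
  have z: "0 < z" "z < 1" using g by (auto simp: z_def)
  define a b where "a = z * q" and "b = d + g / 4"
  have "g / 2 * q \<le> g / 2 * 1" using g q by (intro mult_left_mono) auto
  hence a_ge: "q - g / 2 \<le> a" by (simp add: a_def z_def algebra_simps)
  \<comment> \<open>The exponent of \<open>n\<close> in the lower bound for
    \<open>sqrt n * \<epsilon> * S / sqrt t\<close>, given \<open>S\<close> of order at least
    \<open>n powr - b\<close> and \<open>t\<close> at most \<open>n powr - a\<close>.\<close>
  define e where "e = 1 / 2 - \<beta> - b + a / 2"
  have e: "0 < e" and e': "0 < 1 - \<beta> - b" and ab: "b < a" and a0: "0 < a"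
    using a_ge g q d z assms(5) unfolding e_def b_def a_def g_def by (auto simp: field_simps)
  obtain K where K: "0 < K" "\<And>y. 0 \<le> y \<Longrightarrow> p_value \<gamma> y \<le> K * exp (- z * (y powr \<gamma> / \<gamma>))"
    using p_value_le_exp[of \<gamma> "1 - z"] assms(1) z by auto
  define C where "C = GN_density \<gamma> 0 0"
  have C: "0 < C" using GN_density_pos[OF assms(1)] by (simp add: C_def)
  define T where "T = (\<lambda>n. (\<gamma> * ln (real n)) powr (1 / \<gamma>))"
  define t where "t = (\<lambda>n. p_value \<gamma> (u * T n))"
  define S where "S = (\<lambda>n. p_value \<gamma> (u * T n - s * T n))"
  have lim: "(\<lambda>n. real n powr (- c)) \<longlonglongrightarrow> 0" if "0 < c" for c using that by real_asymp
  have ev_S: "\<forall>\<^sub>F n in sequentially. C * real n powr (- b) \<le> S n"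
    using p_value_ge_powr[of \<gamma> "u - s" b] assms(1) u(1) g
    by (simp add: C_def S_def T_def b_def d_def algebra_simps)
  have t_le: "t n \<le> K * real n powr (- a)" if "2 \<le> n" for n
  proof -
    have L: "0 < ln (real n)" using that by simp
    have T: "0 < T n" "T n powr \<gamma> = \<gamma> * ln (real n)" using L assms(1) by (auto simp: T_def powr_powr)
    have "(u * T n) powr \<gamma> / \<gamma> = q * ln (real n)" using T u s assms(1) by (simp add: powr_mult q_def)
    moreover have "0 \<le> u * T n" using T u s by simp
    ultimately have "t n \<le> K * exp (- z * (q * ln (real n)))" using K(2)[of "u * T n"] by (simp add: t_def)
    also have "exp (- z * (q * ln (real n))) = real n powr (- a)" using that by (simp add: powr_def a_def mult_ac)
    finally show ?thesis .
  qed
  have ev_tS: "\<forall>\<^sub>F n in sequentially. K * real n powr (- (a - b)) < C / 2"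
    using order_tendstoD(2)[OF tendsto_mult[OF tendsto_const[of K] lim[of "a - b"]], of "C / 2"] ab C by simp
  have ev_size: "\<forall>\<^sub>F n in sequentially. K * real n powr (- a) + real n powr (- \<beta>) + 1 / real n < \<alpha>0"
  proof (rule order_tendstoD(2))
    have "(\<lambda>n. K * real n powr (- a) + real n powr (- \<beta>) + 1 / real n) \<longlonglongrightarrow> K * 0 + 0 + 0"
      using a0 assms(5) by (intro tendsto_add tendsto_mult tendsto_const lim) (auto intro: lim_1_over_n)
    thus "(\<lambda>n. K * real n powr (- a) + real n powr (- \<beta>) + 1 / real n) \<longlonglongrightarrow> 0" by simp
  qed (use assms in auto)
  have ev_h: "\<forall>\<^sub>F n in sequentially. h n (\<alpha> n) < C / (4 * sqrt K) * real n powr e"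
    using slow e C K(1) by (intro slowly_enough_eventually_less) auto
  \<comment> \<open>Bounds the failure probability. The two terms stem from the null part and the
    signal part of the mean count in the Chernoff exponent.\<close>
  define B where "B = (\<lambda>n. 64 * K / C\<^sup>2 * real n powr (- (2 * e)) + 64 / C * real n powr (- (1 - \<beta> - b)))"
  have low: "\<forall>\<^sub>F n in sequentially. 1 - B n \<le> HC_power \<gamma> \<alpha>0 h \<alpha> \<beta> r n"
    using ev_S ev_tS ev_size ev_h eventually_ge_at_top[of 2]
  proof eventually_elim
    case (elim n)
    define \<epsilon> where "\<epsilon> = sparsity \<beta> n"
    have n0: "0 < n" and L: "0 < ln (real n)" using elim(5) by auto
    have \<epsilon>: "\<epsilon> = real n powr (- \<beta>)" "0 < \<epsilon>" "\<epsilon> \<le> 1"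
      using sparsity_bounds[of \<beta> n] assms(5) n0 by (auto simp: \<epsilon>_def sparsity_def)
    have \<mu>: "signal_mean \<gamma> r n = s * T n"
      using signal_mean_eq[OF assms(1,7) L refl] by (simp add: s_def T_def)
    have t0: "0 < t n" and S1: "0 < S n" "S n \<le> 1"
      using assms(1) by (auto simp: t_def S_def p_value_pos p_value_le_1)
    note tn = t_le[OF elim(5)]
    have tS: "t n \<le> S n / 2"
    proof -
      have "t n \<le> (K * real n powr (- (a - b))) * real n powr (- b)"
        using tn by (simp add: mult.assoc flip: powr_add)
      also have "\<dots> \<le> (C / 2) * real n powr (- b)" using elim(2) by (intro mult_right_mono) auto
      also have "\<dots> \<le> S n / 2" using elim(1) by simp
      finally show ?thesis .
    qed
    have hc: "h n (\<alpha> n) < sqrt (real n) * \<epsilon> * S n / (4 * sqrt (t n))"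
    proof -
      have "real n powr (1 / 2 + - \<beta> + - b - - a / 2)
          = real n powr (1/2) * real n powr (- \<beta>) * real n powr (- b) / real n powr (- a / 2)"
        unfolding powr_diff powr_add ..
      moreover have "e = 1 / 2 + - \<beta> + - b - - a / 2" by (simp add: e_def)
      ultimately have "C / (4 * sqrt K) * real n powr e
          = real n powr (1/2) * real n powr (- \<beta>) * (C * real n powr (- b)) / (4 * (sqrt K * real n powr (- a / 2)))"
        by (simp add: mult_ac)
      also have "real n powr (1/2) = sqrt (real n)" by (simp add: powr_half_sqrt)
      also have "sqrt K * real n powr (- a / 2) = sqrt (K * real n powr (- a))"
        by (simp add: real_sqrt_mult powr_half_sqrt[symmetric] powr_powr)
      also have "sqrt (real n) * real n powr (- \<beta>) * (C * real n powr (- b)) / (4 * sqrt (K * real n powr (- a)))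
          \<le> sqrt (real n) * \<epsilon> * S n / (4 * sqrt (t n))"
        unfolding \<epsilon>(1)[symmetric] using elim(1) \<epsilon> tn t0 C S1 by (intro frac_le mult_left_mono) auto
      finally show ?thesis using elim(4) by linarith
    qed
    have size: "t n + \<epsilon> + 1 / real n \<le> \<alpha>0" using elim(3) tn by (simp add: \<epsilon>(1))
    let ?Y = "real n * \<epsilon>\<^sup>2 * (S n)\<^sup>2 / (64 * (t n + \<epsilon> * S n))"
    have main: "1 - exp (- ?Y) \<le> HC_power \<gamma> \<alpha>0 h \<alpha> \<beta> r n"
      unfolding HC_power_def H1_law_def \<epsilon>_def[symmetric] \<mu>
      using tS hc size S1
      unfolding t_def S_def
      by (intro prob_HC_exceeds_ge assms(1,3) n0 \<epsilon>) auto
    have Y: "0 < ?Y" using n0 \<epsilon> S1 t0 by (intro divide_pos_pos mult_pos_pos add_pos_pos) auto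
    \<comment> \<open>This polynomial bound suffices, since \<open>?Y\<close> grows at least like a
      power of \<open>n\<close>.\<close>
    have "exp (- ?Y) \<le> 1 / ?Y"
      using Y exp_ge_add_one_self[of ?Y] by (simp only: exp_minus inverse_eq_divide) (intro frac_le; linarith)
    also have "1 / ?Y = 64 * t n / (real n * \<epsilon>\<^sup>2 * (S n)\<^sup>2) + 64 / (real n * \<epsilon> * S n)"
      using n0 \<epsilon>(2) S1(1) t0 by (simp add: power2_eq_square field_simps)
    also have "\<dots> \<le> 64 * (K * real n powr (- a)) / (real n * \<epsilon>\<^sup>2 * (C * real n powr (- b))\<^sup>2) + 64 / (real n * \<epsilon> * (C * real n powr (- b)))"
      using n0 \<epsilon>(2) S1(1) t0 tn elim(1) C K(1)
      by (intro add_mono frac_le mult_left_mono power_mono mult_pos_pos mult_nonneg_nonneg) auto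
    also have "\<dots> = B n"
    proof -
      have "real n powr (- (2 * e)) = real n powr (- a) / (real n * \<epsilon>\<^sup>2 * (real n powr (- b))\<^sup>2)"
      proof -
        have "real n * \<epsilon>\<^sup>2 * (real n powr (- b))\<^sup>2 = real n powr (1 + (- \<beta> + - \<beta>) + (- b + - b))"
          unfolding \<epsilon>(1) power2_eq_square powr_add using n0 by simp
        thus ?thesis by (simp add: e_def algebra_simps flip: powr_diff)
      qed
      moreover have "real n powr (- (1 - \<beta> - b)) = 1 / (real n * \<epsilon> * real n powr (- b))"
      proof -
        have "real n * \<epsilon> * real n powr (- b) = real n powr (1 + - \<beta> + - b)"
          unfolding \<epsilon>(1) powr_add using n0 by simp
        thus ?thesis by (simp add: powr_minus_divide[symmetric] algebra_simps)
      qed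
      ultimately show ?thesis
        unfolding B_def by (simp add: power_mult_distrib mult_ac)
    qed
    finally show ?case using main by linarith
  qed
  have up: "\<forall>\<^sub>F n in sequentially. HC_power \<gamma> \<alpha>0 h \<alpha> \<beta> r n \<le> 1"
  proof (rule always_eventually, rule allI)
    fix n
    interpret M: prob_space "GN_mixture \<gamma> (sparsity \<beta> n) (signal_mean \<gamma> r n)"
      using assms(1,5) by (intro prob_space_GN_mixture sparsity_bounds) auto
    interpret P: product_prob_space "\<lambda>_. GN_mixture \<gamma> (sparsity \<beta> n) (signal_mean \<gamma> r n)" "{1..n}" by standard
    show "HC_power \<gamma> \<alpha>0 h \<alpha> \<beta> r n \<le> 1"
      unfolding HC_power_def H1_law_def by (rule P.P.prob_le_1)
  qed
  have "(\<lambda>n. 1 - B n) \<longlonglongrightarrow> 1 - (64 * K / C\<^sup>2 * 0 + 64 / C * 0)"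
    unfolding B_def using e e'
    by (intro tendsto_add tendsto_diff tendsto_mult tendsto_const lim) auto
  hence B: "(\<lambda>n. 1 - B n) \<longlonglongrightarrow> 1" by simp
  show ?thesis by (rule tendsto_sandwich[OF low up B tendsto_const])
qed

theorem theorem5p1:
  fixes \<gamma> \<alpha>0 :: real and h :: "nat \<Rightarrow> real \<Rightarrow> real" and \<alpha> :: "nat \<Rightarrow> real"
  assumes "\<gamma> > 0" and "0 < \<alpha>0" and "\<alpha>0 < 1"
    and "HC_critical_value \<gamma> \<alpha>0 h"
    and "\<And>n. 0 < \<alpha> n \<and> \<alpha> n < 1"
    and "tends_to_0_slowly_enough h \<alpha>"
  shows "is_detection_boundary (HC_power \<gamma> \<alpha>0 h \<alpha>) (rho_star \<gamma>)"
  unfolding is_detection_boundary_def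
  using HC_power_tendsto_1[OF assms(1-3,6)] HC_power_tendsto_0[OF assms] by blast


end
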